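(* Let $d\ge 1$, let $\phi:\mathbb{R}\to\mathbb{R}$ be a normalized activation function (see context), and let $m_n$ denote the infinitely wide and deep network classifier with activation $\phi$ trained on $n$ examples with distinct inputs $x^{(1)},\dots,x^{(n)}\in\mathcal{S}_+^d$ and labels $y^{(i)}\in\{-1,1\}$: $$m_n(x)=\lim_{L\to\infty}\operatorname{sign}\Big(y\,\big(K_n^{(L)}\big)^{-1}K^{(L)}(X,x)\Big).$$ For $z\sim\mathcal{N}(0,1)$ define $A=\mathbb{E}[\phi(z)]$ and $A'=\mathbb{E}[\phi'(z)]$. If $A=A'=0$, then $m_n$ implements 1-nearest-neighbor classification on $\mathcal{S}_+^{d}$: for every $x\in\mathcal{S}_+^d$ with a unique nearest training input $x^{(i)}$ in Euclidean distance, $m_n(x)=y^{(i)}$.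
   Context: $\mathcal{S}_+^{d}$ is the intersection of the unit sphere $\mathcal{S}^d\subset\mathbb{R}^{d+1}$ with the non-negative orthant. Normalized activation function: a (weakly) differentiable $\phi:\mathbb{R}\to\mathbb{R}$ with $\mathbb{E}[\phi(z)^2]=1$ and $\mathbb{E}[\phi'(z)^2]<\infty$ for $z\sim\mathcal{N}(0,1)$. Dual activation: $\check{\phi}:[-1,1]\to\mathbb{R}$, $\check{\phi}(z)=\mathbb{E}[\phi(u)\phi(v)]$ where $(u,v)$ is a centered Gaussian vector with covariance $\begin{pmatrix} 1 & z \\ z & 1 \end{pmatrix}$; $\check{\phi}'$ is its derivative. One has $A^2=\check\phi(0)$, $(A')^2=\check\phi'(0)$. Write $\check{\phi}^{(0)}(z)=z$ and $\check{\phi}^{(L)}=\check{\phi}\circ\check{\phi}^{(L-1)}$. Neural Tangent Kernel (NTK) of the (infinitely wide, bias-free) fully connected network with $L$ hidden layers and activation $\phi$, on the unit sphere: $K^{(L)}(x,\tilde{x})=K^{(L)}(z)$ with $z=x^T\tilde{x}$, where $$K^{(0)}(z)=z,\qquad K^{(L)}(z)=\check{\phi}^{(L)}(z)+K^{(L-1)}(z)\,\check{\phi}'\big(\check{\phi}^{(L-1)}(z)\big).$$ Kernel machine notation: $X=[x^{(1)}|\dots|x^{(n)}]$, $y=[y^{(1)},\dots,y^{(n)}]\in\{-1,1\}^{1\times n}$, $(K_n^{(L)})_{i,j}=K^{(L)}(x^{(i)},x^{(j)})$, and $K^{(L)}(X,x)\in\mathbb{R}^n$ with $i$-th entry $K^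{(L)}(x^{(i)},x)$.
   Formalization: For n = 1 the formal theorem additionally requires that x is not orthogonal to the single training input; there K^(L)(0) = 0 for all L, so m_n(x) = sign(0) regardless of the label and the claim fails. For n ≥ 2 nothing is added. *)

theory Defs
  imports "HOL-Probability.Probability"
begin

section \<open>Weak derivatives and normalized activations\<close>

definition test_function :: "(real \<Rightarrow> real) \<Rightarrow> bool" where
  "test_function \<psi> \<longleftrightarrow>
     (\<forall>k. (deriv ^^ k) \<psi> differentiable_on UNIV) \<and> compact (closure {x. \<psi> x \<noteq> 0})"

text \<open>
  Local integrability of both functions includes their Borel measurability, since
  \<^const>\<open>lborel\<close> carries the Borel sigma-algebra.
\<close>

definition weak_derivative :: "(real \<Rightarrow> real) \<Rightarrow> (real \<Rightarrow> real) \<Rightarrow> bool" where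
  "weak_derivative \<phi> \<phi>' \<longleftrightarrow>
     (\<forall>a b. set_integrable lborel {a..b} \<phi>) \<and>
     (\<forall>a b. set_integrable lborel {a..b} \<phi>') \<and>
     (\<forall>\<psi>. test_function \<psi> \<longrightarrow>
        (LINT x|lborel. \<phi> x * deriv \<psi> x) = - (LINT x|lborel. \<phi>' x * \<psi> x))"

text \<open>
  The derivative is a parameter: a weak derivative is determined only almost everywhere.
  The integrability conditions say that the two expectations are finite; without them a
  divergent Bochner integral would be zero.
\<close>

definition normalized_activation :: "(real \<Rightarrow> real) \<Rightarrow> (real \<Rightarrow> real) \<Rightarrow> bool" where
  "normalized_activation \<phi> \<phi>' \<longleftrightarrow>
     weak_derivative \<phi> \<phi>' \<and>
     integrable std_normal_distribution (\<lambda>z. (\<phi> z)\<^sup>2) \<and>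
     (LINT z|std_normal_distribution. (\<phi> z)\<^sup>2) = 1 \<and>
     integrable std_normal_distribution (\<lambda>z. (\<phi>' z)\<^sup>2)"


section \<open>Dual activation\<close>

text \<open>
  For \<open>-1 \<le> z \<le> 1\<close>, the law of the centered Gaussian vector \<open>(u, v)\<close> with
  \<open>E u\<^sup>2 = E v\<^sup>2 = 1\<close> and \<open>E (u v) = z\<close>, as the image of two independent standard normal
  variables under a linear map. The degenerate cases \<open>z = 1\<close> and \<open>z = -1\<close> are covered.
\<close>

definition gaussian_pair :: "real \<Rightarrow> (real \<times> real) measure" where
  "gaussian_pair z =
     distr (std_normal_distribution \<Otimes>\<^sub>M std_normal_distribution) borel
       (\<lambda>(g, h). (g, z * g + sqrt (1 - z\<^sup>2) * h))"

definition dual_activation :: "(real \<Rightarrow> real) \<Rightarrow> real \<Rightarrow> real" where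
  "dual_activation \<phi> z = (LINT p|gaussian_pair z. \<phi> (fst p) * \<phi> (snd p))"

text \<open>
  The dual activation is a function on \<open>[-1, 1]\<close>, so its derivative is one-sided at the
  end points.
\<close>

definition dual_activation_deriv :: "(real \<Rightarrow> real) \<Rightarrow> real \<Rightarrow> real" where
  "dual_activation_deriv \<phi> z =
     vector_derivative (dual_activation \<phi>) (at z within {-1..1})"


section \<open>Neural tangent kernel and its classifier\<close>

primrec ntk :: "(real \<Rightarrow> real) \<Rightarrow> nat \<Rightarrow> real \<Rightarrow> real" where
  "ntk \<phi> 0 z = z"
| "ntk \<phi> (Suc L) z =
     (dual_activation \<phi> ^^ Suc L) z
     + ntk \<phi> L z * dual_activation_deriv \<phi> ((dual_activation \<phi> ^^ L) z)"

definition ntk_gram ::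
    "(real \<Rightarrow> real) \<Rightarrow> nat \<Rightarrow> ('n \<Rightarrow> real ^ 'k) \<Rightarrow> real ^ 'n ^ ('n::finite)" where
  "ntk_gram \<phi> L X = (\<chi> i j. ntk \<phi> L (X i \<bullet> X j))"

definition ntk_vec ::
    "(real \<Rightarrow> real) \<Rightarrow> nat \<Rightarrow> ('n \<Rightarrow> real ^ 'k) \<Rightarrow> real ^ 'k \<Rightarrow> real ^ ('n::finite)" where
  "ntk_vec \<phi> L X x = (\<chi> i. ntk \<phi> L (X i \<bullet> x))"

definition ntk_sign ::
    "(real \<Rightarrow> real) \<Rightarrow> ('n \<Rightarrow> real ^ 'k) \<Rightarrow> real ^ ('n::finite) \<Rightarrow> nat \<Rightarrow> real ^ 'k \<Rightarrow> real" where
  "ntk_sign \<phi> X y L x = sgn ((y v* matrix_inv (ntk_gram \<phi> L X)) \<bullet> ntk_vec \<phi> L X x)"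

definition deep_classifier ::
    "(real \<Rightarrow> real) \<Rightarrow> ('n \<Rightarrow> real ^ 'k) \<Rightarrow> real ^ ('n::finite) \<Rightarrow> real ^ 'k \<Rightarrow> real" where
  "deep_classifier \<phi> X y x = lim (\<lambda>L. ntk_sign \<phi> X y L x)"

definition nonneg_sphere :: "(real ^ 'k) set" where
  "nonneg_sphere = {x \<in> sphere 0 1. \<forall>k. 0 \<le> x $ k}"

end

theory Submission
  imports Defs "HOL-Complex_Analysis.Complex_Analysis" "HOL-Real_Asymp.Real_Asymp"
begin

text \<open>
  With \<open>h\<^sub>k\<close> the normalized Hermite polynomials and \<open>a\<^sub>k = E (\<phi> h\<^sub>k)\<close>, Mehler's formula and
  Parseval's identity give \<open>dual_activation \<phi> z = (\<Sum>k. a\<^sub>k\<^sup>2 * z ^ k)\<close> for \<open>-1 < z \<le> 1\<close>. Gaussian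
  integration by parts turns the weak derivative into \<open>E (\<phi>' h\<^sub>k) = sqrt (k + 1) * a\<^sub>k\<^sub>+\<^sub>1\<close>; hence
  the series may be differentiated up to the end point \<open>1\<close>, and \<open>A = A' = 0\<close> means that it
  starts with \<open>z\<^sup>2\<close>. So if \<open>w \<le> r * z\<close>, one layer improves the ratio from \<open>r\<close> to \<open>r\<^sup>2\<close> and the
  tangent kernel satisfies \<open>K\<^sup>L w / K\<^sup>L z \<rightarrow> 0\<close> whenever \<open>0 \<le> w < z \<le> 1\<close>. Taking \<open>z = 1\<close>, the
  Gram matrix divided by \<open>K\<^sup>L 1\<close> tends to the identity; in the kernel vector the entry of the
  nearest neighbour dominates all others, so it decides the sign.
\<close>

text \<open>Nonnegativity, both of the coefficients a_k^2 and of the inner products on the orthant,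
  is what lets every comparison be made term by term. Only ratios carry information: for 0 \<le> z <
  1 the value K^L(z) itself tends to 0, while K^L(1) stays at least 1. Away from the training points
  the kernel vector therefore vanishes in the limit, and convergence of the scaled Gram matrix to
  the identity does not by itself decide a sign. The error made by replacing the inverse with a
  multiple of the identity has to be small relative to the entry of the nearest neighbour, so the
  linear algebra is stated in terms of the largest entry of the right-hand side. The analytic
  obstacle is the end point. Mehler's kernel is a density only for \<bar>z\<bar> < 1, whereas the
  diagonal of the Gram matrix is K^L(1). The value of the series at 1 rests on completeness of the
  Hermite system, and its derivative there on the square-integrability of the weak
  derivative.\<close>

abbreviation "gauss \<equiv> std_normal_distribution"

lemma prob_space_gauss: "prob_space gauss"
  using real_dist_normal_dist by (simp add: real_distribution_def)

interpretation gauss: prob_space gauss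
  by (rule prob_space_gauss)

interpretation gauss2: pair_prob_space gauss gauss ..

section \<open>Hermite polynomials\<close>

text \<open>The probabilists' convention, with leading coefficient one. The raising operator x -
  d/dx is the adjoint of d/dx under the Gaussian measure, so orthogonality and the rule for weak
  derivatives both become integration by parts.\<close>

primrec hermite :: "nat \<Rightarrow> real poly" where
  "hermite 0 = 1"
| "hermite (Suc k) = pCons 0 (hermite k) - pderiv (hermite k)"

text \<open>The commutator of d/dx with x - d/dx is the identity, so each of the
  \<open>Suc k\<close> raisings contributes one copy of \<open>hermite k\<close>.\<close>

lemma pderiv_hermite: "pderiv (hermite (Suc k)) = smult (real (Suc k)) (hermite k)"
proof (induction k)
  case (Suc k)
  have "pderiv (hermite (Suc (Suc k)))
      = pderiv (pCons 0 (hermite (Suc k))) - pderiv (smult (real (Suc k)) (hermite k))"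
    by (simp only: hermite.simps(2)[of "Suc k"] pderiv_diff Suc.IH)
  also have "\<dots> = hermite (Suc k) + smult (real (Suc k)) (pCons 0 (hermite k) - pderiv (hermite k))"
    by (simp only: pderiv_pCons Suc.IH pderiv_smult smult_diff_right) (simp add: algebra_simps)
  also have "\<dots> = smult (real (Suc (Suc k))) (hermite (Suc k))"
    by (simp only: hermite.simps(2)[symmetric]) (simp add: poly_eq_iff algebra_simps del: hermite.simps)
  finally show ?case .
qed (simp add: pderiv_pCons)

lemma borel_measurable_poly [measurable]: "poly (p :: real poly) \<in> borel_measurable borel"
  by (intro borel_measurable_continuous_onI continuous_intros)

lemma poly_pCons_0: "poly (pCons 0 p) = (\<lambda>x. x * poly p x)"
  by auto

lemma integrable_poly: "integrable gauss (poly p)"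
  by (simp add: poly_altdef[abs_def] integrable_std_normal_distribution_moment)

text \<open>Integration by parts for monomials, read off from the closed moment formulas. For even
  \<open>n\<close> both sides involve odd moments and vanish; at \<open>n = 0\<close> the truncated
  exponent is masked by the factor zero.\<close>

lemma gauss_moment_rec:
  "(LINT x|gauss. x ^ Suc n) = real n * (LINT x|gauss. x ^ (n - 1))"
proof (cases "even n")
  case True
  show ?thesis
  proof (cases "n = 0")
    case False
    then show ?thesis using True
      by (simp add: integral_std_normal_distribution_moment_odd del: power_Suc)
  qed (use integral_std_normal_distribution_moment_odd[of 1] in simp)
next
  case False
  then obtain m where m: "n = 2 * m + 1" by (auto elim: oddE)
  have "(LINT x|gauss. x ^ Suc n) = (LINT x|gauss. x ^ (2 * Suc m))"
    by (simp add: m del: power_Suc)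
  also have "\<dots> = real n * (LINT x|gauss. x ^ (2 * m))"
  proof -
    have "fact (2 * Suc m) = (2 * real (Suc m)) * (real n * fact (2 * m))"
      by (simp add: m algebra_simps)
    moreover have "2 ^ Suc m * fact (Suc m) = (2 * real (Suc m)) * (2 ^ m * fact m)"
      by simp
    ultimately show ?thesis
      by (simp only: std_normal_distribution_even_moments mult_divide_mult_cancel_left_if) simp
  qed
  finally show ?thesis by (simp add: m)
qed

lemma gauss_stein_poly: "(LINT x|gauss. x * poly p x) = (LINT x|gauss. poly (pderiv p) x)"
proof -
  have *: "(LINT x|gauss. x * poly (monom a i) x) = (LINT x|gauss. poly (pderiv (monom a i)) x)"
    for a :: real and i
  proof -
    have "(LINT x|gauss. x * poly (monom a i) x) = a * (LINT x|gauss. x ^ Suc i)"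
      by (simp add: poly_monom mult.left_commute flip: integral_mult_right_zero)
    then show ?thesis
      by (simp only: gauss_moment_rec) (simp add: pderiv_monom poly_monom mult_ac)
  qed
  define c where "c = coeff p"
  have p: "p = (\<Sum>i\<le>degree p. monom (c i) i)"
    by (simp add: c_def poly_as_sum_of_monoms)
  have 1: "integrable gauss (\<lambda>x. x * poly (monom (c i) i) x)" for i
    using integrable_poly[of "pCons 0 (monom (c i) i)"] by (simp only: poly_pCons_0)
  have "(LINT x|gauss. x * poly p x)
      = (LINT x|gauss. (\<Sum>i\<le>degree p. x * poly (monom (c i) i) x))"
    by (subst p) (simp only: poly_sum sum_distrib_left)
  also have "\<dots> = (\<Sum>i\<le>degree p. LINT x|gauss. poly (pderiv (monom (c i) i)) x)"
    by (subst Bochner_Integration.integral_sum) (simp_all only: 1 *)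
  also have "\<dots> = (LINT x|gauss. poly (\<Sum>i\<le>degree p. pderiv (monom (c i) i)) x)"
    by (simp only: poly_sum) (simp add: Bochner_Integration.integral_sum integrable_poly)
  also have "(\<Sum>i\<le>degree p. pderiv (monom (c i) i)) = pderiv p"
    by (subst (2) p) (simp only: higher_pderiv_sum[of 1, simplified])
  finally show ?thesis .
qed

text \<open>Stein's identity for \<open>hermite k * p\<close>: one term of the product rule cancels
  the \<open>pderiv (hermite k)\<close> of the recursion, and the derivative lands on
  \<open>p\<close> alone.\<close>

lemma gauss_hermite_adjoint:
  "(LINT x|gauss. poly (hermite (Suc k) * p) x) = (LINT x|gauss. poly (hermite k * pderiv p) x)"
proof -
  have "(LINT x|gauss. poly (hermite (Suc k) * p) x)
      = (LINT x|gauss. poly (pCons 0 (hermite k * p)) x - poly (pderiv (hermite k) * p) x)"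
    by (intro Bochner_Integration.integral_cong) (simp_all add: algebra_simps)
  also have "\<dots> = (LINT x|gauss. x * poly (hermite k * p) x) - (LINT x|gauss. poly (pderiv (hermite k) * p) x)"
    by (subst Bochner_Integration.integral_diff[OF integrable_poly integrable_poly]) (simp only: poly_pCons_0)
  also have "\<dots> = (LINT x|gauss. poly (pderiv (hermite k * p) - pderiv (hermite k) * p) x)"
    unfolding gauss_stein_poly poly_diff
    by (subst Bochner_Integration.integral_diff[OF integrable_poly integrable_poly]) simp
  finally show ?thesis by (simp add: pderiv_mult mult.commute)
qed

text \<open>Moving one raising across the integral lowers both degrees at once and releases a
  factor; these factors multiply up to the factorial. With unequal degrees a constant is
  differentiated in the end.\<close>

lemma hermite_orthogonal:
  "(LINT x|gauss. poly (hermite j * hermite k) x) = (if j = k then fact k else 0)"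
proof (induction k arbitrary: j)
  case 0
  show ?case
  proof (cases j)
    case (Suc i)
    then show ?thesis using gauss_hermite_adjoint[of i 1] by (simp add: pderiv_1)
  qed (use gauss.prob_space in simp)
next
  case (Suc k)
  show ?case
  proof (cases j)
    case 0
    then show ?thesis using gauss_hermite_adjoint[of k 1] by (simp add: pderiv_1 mult.commute)
  next
    case (Suc i)
    then show ?thesis
      by (simp only: gauss_hermite_adjoint pderiv_hermite mult_smult_right poly_smult)
        (use Suc.IH[of i] in simp)
  qed
qed

definition herm :: "nat \<Rightarrow> real \<Rightarrow> real" where
  "herm k x = poly (hermite k) x / sqrt (fact k)"

lemma borel_measurable_herm [measurable]: "herm k \<in> borel_measurable borel"
  unfolding herm_def[abs_def] by measurable

lemma herm_orthonormal: "(LINT x|gauss. herm j x * herm k x) = (if j = k then 1 else 0)"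
proof -
  have "(LINT x|gauss. herm j x * herm k x)
      = (LINT x|gauss. poly (hermite j * hermite k) x) / (sqrt (fact j) * sqrt (fact k))"
    by (simp add: herm_def)
  then show ?thesis by (simp only: hermite_orthogonal) simp
qed

lemma integrable_herm_mult: "integrable gauss (\<lambda>x. herm j x * herm k x)"
  using integrable_divide[OF integrable_poly[of "hermite j * hermite k"], of "sqrt (fact j) * sqrt (fact k)"]
  by (simp add: herm_def)

section \<open>Square-integrable functions and Bessel's inequality\<close>

text \<open>Measurability is asked of the function itself, since a measurable square does not
  provide it.\<close>

definition square_int :: "(real \<Rightarrow> real) \<Rightarrow> bool" where
  "square_int f \<longleftrightarrow> f \<in> borel_measurable borel \<and> integrable gauss (\<lambda>x. (f x)\<^sup>2)"

definition hcoeff :: "(real \<Rightarrow> real) \<Rightarrow> nat \<Rightarrow> real" where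
  "hcoeff f k = (LINT x|gauss. f x * herm k x)"

lemma square_int_herm: "square_int (herm k)"
  using integrable_herm_mult[of k k] by (simp add: square_int_def power2_eq_square)

lemma abs_mult_le_squares: "\<bar>a * b\<bar> \<le> (a\<^sup>2 + b\<^sup>2) / 2" for a b :: real
  using sum_squares_bound[of "\<bar>a\<bar>" "\<bar>b\<bar>"] by (simp add: abs_mult)

lemma square_int_mult:
  assumes "square_int f" "square_int g"
  shows "integrable gauss (\<lambda>x. f x * g x)"
proof (rule Bochner_Integration.integrable_bound)
  show "integrable gauss (\<lambda>x. ((f x)\<^sup>2 + (g x)\<^sup>2) / 2)"
    using assms by (auto simp: square_int_def)
  show "(\<lambda>x. f x * g x) \<in> borel_measurable gauss"
    using assms by (auto simp: square_int_def)
  show "AE x in gauss. norm (f x * g x) \<le> norm (((f x)\<^sup>2 + (g x)\<^sup>2) / 2)"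
    unfolding real_norm_def
    by (intro AE_I2 order_trans[OF abs_mult_le_squares abs_ge_self])
qed

lemma square_int_lincomb:
  assumes "square_int f" "square_int g"
  shows "square_int (\<lambda>x. a * f x + b * g x)"
proof -
  have "integrable gauss (\<lambda>x. a\<^sup>2 * (f x)\<^sup>2 + 2 * a * b * (f x * g x) + b\<^sup>2 * (g x)\<^sup>2)"
    using assms square_int_mult[OF assms] unfolding square_int_def by auto
  then show ?thesis
    using assms by (auto simp: square_int_def power2_eq_square algebra_simps)
qed

lemma square_int_add: "square_int f \<Longrightarrow> square_int g \<Longrightarrow> square_int (\<lambda>x. f x + g x)"
  and square_int_diff: "square_int f \<Longrightarrow> square_int g \<Longrightarrow> square_int (\<lambda>x. f x - g x)"
  using square_int_lincomb[of f g 1 1] square_int_lincomb[of f g 1 "-1"] by simp_all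

lemma square_int_sum_herm: "square_int (\<lambda>x. \<Sum>k<n. c k * herm k x)"
proof (induction n)
  case 0
  show ?case by (simp add: square_int_def)
next
  case (Suc n)
  from square_int_lincomb[OF this square_int_herm[of n], of 1 "c n"] show ?case by simp
qed

lemma hcoeff_diff:
  "square_int f \<Longrightarrow> square_int g \<Longrightarrow> hcoeff (\<lambda>x. f x - g x) k = hcoeff f k - hcoeff g k"
  and hcoeff_add:
  "square_int f \<Longrightarrow> square_int g \<Longrightarrow> hcoeff (\<lambda>x. f x + g x) k = hcoeff f k + hcoeff g k"
  by (simp_all add: hcoeff_def algebra_simps square_int_mult square_int_herm)

lemma bessel:
  assumes "square_int f"
  shows "(\<Sum>k<n. (hcoeff f k)\<^sup>2) \<le> (LINT x|gauss. (f x)\<^sup>2)"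
proof -
  define g where "g x = (\<Sum>k<n. hcoeff f k * herm k x)" for x
  have g: "square_int g" unfolding g_def by (rule square_int_sum_herm)
  have "(LINT x|gauss. f x * g x) = (\<Sum>k<n. (hcoeff f k)\<^sup>2)"
  proof -
    have "(LINT x|gauss. f x * g x) = (LINT x|gauss. (\<Sum>k<n. hcoeff f k * (f x * herm k x)))"
      by (simp add: g_def sum_distrib_left mult_ac)
    also have "\<dots> = (\<Sum>k<n. hcoeff f k * (LINT x|gauss. f x * herm k x))"
      by (subst Bochner_Integration.integral_sum)
        (simp_all add: square_int_mult[OF assms square_int_herm])
    finally show ?thesis by (simp add: hcoeff_def[symmetric] power2_eq_square)
  qed
  moreover have "(LINT x|gauss. g x * g x) = (\<Sum>k<n. (hcoeff f k)\<^sup>2)"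
  proof -
    have "(LINT x|gauss. g x * g x)
        = (LINT x|gauss. (\<Sum>k<n. \<Sum>j<n. hcoeff f k * hcoeff f j * (herm k x * herm j x)))"
      by (simp add: g_def sum_product mult_ac)
    also have "\<dots> = (\<Sum>k<n. \<Sum>j<n. hcoeff f k * hcoeff f j * (LINT x|gauss. herm k x * herm j x))"
      by (simp add: Bochner_Integration.integral_sum integrable_herm_mult)
    also have "\<dots> = (\<Sum>k<n. (hcoeff f k)\<^sup>2)"
      by (simp add: herm_orthonormal power2_eq_square if_distrib cong: if_cong)
    finally show ?thesis .
  qed
  moreover have "0 \<le> (LINT x|gauss. (f x - g x)\<^sup>2)"
    by (rule integral_nonneg_AE) simp
  moreover have "(LINT x|gauss. (f x - g x)\<^sup>2)
      = (LINT x|gauss. (f x)\<^sup>2) - 2 * (LINT x|gauss. f x * g x) + (LINT x|gauss. g x * g x)"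
  proof -
    have "(LINT x|gauss. (f x - g x)\<^sup>2) = (LINT x|gauss. ((f x)\<^sup>2 - 2 * (f x * g x)) + g x * g x)"
      by (simp add: power2_eq_square algebra_simps)
    also have "\<dots> = (LINT x|gauss. (f x)\<^sup>2) - 2 * (LINT x|gauss. f x * g x) + (LINT x|gauss. g x * g x)"
      using assms square_int_mult[OF assms g] square_int_mult[OF g g]
      by (simp add: square_int_def)
    finally show ?thesis .
  qed
  ultimately show ?thesis by linarith
qed

lemma summable_hcoeff: "square_int f \<Longrightarrow> summable (\<lambda>k. (hcoeff f k)\<^sup>2)"
  by (rule summableI_nonneg_bounded[OF _ bessel]) auto

lemma suminf_hcoeff_le: "square_int f \<Longrightarrow> (\<Sum>k. (hcoeff f k)\<^sup>2) \<le> (LINT x|gauss. (f x)\<^sup>2)"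
  by (rule suminf_le_const[OF summable_hcoeff bessel])

section \<open>Mehler's formula\<close>

lemma poly_hermite_rec:
  "poly (hermite (Suc (Suc k))) x = x * poly (hermite (Suc k)) x - real (Suc k) * poly (hermite k) x"
  by (simp only: hermite.simps(2)[of "Suc k"] pderiv_hermite) simp

text \<open>For \<bar>z\<bar> < 1 this is the joint density of a standard normal pair with
  correlation \<open>z\<close>, relative to two independent standard normal variables.\<close>

definition mehler :: "real \<Rightarrow> real \<Rightarrow> real \<Rightarrow> real" where
  "mehler z u v = exp ((z * u * v - z\<^sup>2 * (u\<^sup>2 + v\<^sup>2) / 2) / (1 - z\<^sup>2)) / sqrt (1 - z\<^sup>2)"

context
  fixes u v :: real
begin

text \<open>The complex kernel satisfies
  \<open>(1 - z\<^sup>2)\<^sup>2 M' = (u v (1 + z\<^sup>2) + z (1 - u\<^sup>2 - v\<^sup>2) - z\<^sup>3) M\<close>. Read off coefficientwise, this is a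
  recursion that determines the Taylor coefficients and that the products of Hermite
  polynomials satisfy as well; holomorphy on the unit disc gives convergence for free.\<close>

definition cmehler :: "complex \<Rightarrow> complex" where
  "cmehler z = exp ((z * of_real (u * v) - z\<^sup>2 * of_real (u\<^sup>2 + v\<^sup>2) / 2) / (1 - z\<^sup>2)) / csqrt (1 - z\<^sup>2)"

text \<open>Keeps \<open>1 - z\<^sup>2\<close> off the branch cut of \<open>csqrt\<close> and away
  from zero on the whole unit disc.\<close>

lemma one_minus_square_pos:
  assumes "norm (z :: complex) < 1"
  shows "0 < Re (1 - z\<^sup>2)"
proof -
  have "norm (z\<^sup>2) < 1"
    using assms by (simp add: norm_power power_less_one_iff)
  then show ?thesis using complex_Re_le_cmod[of "z\<^sup>2"] by simp
qed

lemma has_field_derivative_cmehler: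
  assumes "norm z < 1"
  shows "(cmehler has_field_derivative
    (of_real (u * v) * (1 + z\<^sup>2) + z * (1 - of_real (u\<^sup>2 + v\<^sup>2)) - z ^ 3) / (1 - z\<^sup>2)\<^sup>2 * cmehler z) (at z)"
proof -
  define w where "w = 1 - z\<^sup>2"
  define s p where "s = complex_of_real (u\<^sup>2 + v\<^sup>2)" and "p = complex_of_real (u * v)"
  \<comment> \<open>With the root and the exponential treated as atoms, and
    \<open>q\<^sup>2 = w\<close> as their only relation, the outcome of the quotient rule is checked
    by rational algebra.\<close>
  define q e where "q = csqrt w" and "e = exp ((z * p - z\<^sup>2 * s / 2) / w)"
  have w: "w \<notin> \<real>\<^sub>\<le>\<^sub>0" "w \<noteq> 0"
    using one_minus_square_pos[OF assms] by (auto simp: w_def complex_nonpos_Reals_iff)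
  have q: "q \<noteq> 0" "q\<^sup>2 = w" using w by (auto simp: q_def)
  have "(cmehler has_field_derivative
      (e * (((p - 2 * z * s / 2) * w - (z * p - z\<^sup>2 * s / 2) * (- 2 * z)) / (w * w)) * q
        - e * (- 2 * z * inverse (2 * q))) / (q * q)) (at z)"
    unfolding cmehler_def[abs_def] s_def[symmetric] p_def[symmetric]
    by (rule derivative_eq_intros has_field_derivative_csqrt refl
        | use w q in \<open>force simp: w_def q_def e_def field_simps\<close>)+
  moreover have "(e * (((p - 2 * z * s / 2) * w - (z * p - z\<^sup>2 * s / 2) * (- 2 * z)) / (w * w)) * q
        - e * (- 2 * z * inverse (2 * q))) / (q * q)
      = ((p - z * s) * w + 2 * z * (z * p - z\<^sup>2 * s / 2) + z * w) / w\<^sup>2 * (e / q)"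
    using w(2) q(1) unfolding q(2)[symmetric]
    by (simp add: divide_simps power2_eq_square) algebra
  moreover have "(p - z * s) * w + 2 * z * (z * p - z\<^sup>2 * s / 2) + z * w
      = p * (1 + z\<^sup>2) + z * (1 - s) - z ^ 3"
    unfolding w_def by (simp add: field_simps power2_eq_square power3_eq_cube)
  moreover have "e / q = cmehler z"
    by (simp add: e_def q_def w_def cmehler_def s_def p_def)
  ultimately show ?thesis
    by (simp add: s_def p_def w_def)
qed

lemma cmehler_holomorphic: "cmehler holomorphic_on ball 0 1"
  unfolding holomorphic_on_open[OF open_ball] Ball_def mem_ball_0
  by (intro allI impI exI) (rule has_field_derivative_cmehler)

text \<open>Multiplication by (1 - z^2)^2 gives the differential equation polynomial coefficients.
  Its quartic term reaches back four indices, so the coefficients up to 3 need equations of their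
  own.\<close>

lemma cmehler_coeff_rec:
  defines "c \<equiv> \<lambda>k. fps_nth (fps_expansion cmehler 0) k"
    and "s \<equiv> complex_of_real (u\<^sup>2 + v\<^sup>2)" and "p \<equiv> complex_of_real (u * v)"
  shows "c 0 = 1" "c 1 = p" "2 * c 2 = p * c 1 + (1 - s) * c 0"
    "3 * c 3 = p * c 2 + (3 - s) * c 1 + p * c 0"
    "of_nat (k + 4) * c (k + 4)
      = p * c (k + 3) + (of_nat (2 * k + 5) - s) * c (k + 2) + p * c (k + 1) - of_nat (k + 1) * c k"
proof -
  let ?F = "fps_expansion cmehler 0"
  let ?L = "(1 - 2 * fps_X\<^sup>2 + fps_X ^ 4) * fps_deriv ?F"
  let ?R = "(fps_const p * (1 + fps_X\<^sup>2) + fps_X * (1 - fps_const s) - fps_X ^ 3) * ?F"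
  have F: "cmehler has_fps_expansion ?F"
    by (rule has_fps_expansion_fps_expansion[OF _ _ cmehler_holomorphic]) auto
  have L: "(\<lambda>z. (1 - 2 * z\<^sup>2 + z ^ 4) * deriv cmehler z) has_fps_expansion ?L"
    by (intro fps_expansion_intros F)
  have R: "(\<lambda>z. (p * (1 + z\<^sup>2) + z * (1 - s) - z ^ 3) * cmehler z) has_fps_expansion ?R"
    by (intro fps_expansion_intros F)
  have "eventually (\<lambda>z :: complex. z \<in> ball 0 1) (nhds 0)"
    by (intro eventually_nhds_in_open) auto
  then have "eventually (\<lambda>z. (1 - 2 * z\<^sup>2 + z ^ 4) * deriv cmehler z
      = (p * (1 + z\<^sup>2) + z * (1 - s) - z ^ 3) * cmehler z) (nhds 0)"
  proof eventually_elim
    case (elim z)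
    then have z: "norm z < 1" by simp
    have "1 - 2 * z\<^sup>2 + z ^ 4 = (1 - z\<^sup>2)\<^sup>2" by (simp add: power2_eq_square power4_eq_xxxx algebra_simps)
    moreover have "1 - z\<^sup>2 \<noteq> 0" using one_minus_square_pos[OF z] by force
    ultimately show ?case
      using DERIV_imp_deriv[OF has_field_derivative_cmehler[OF z]] by (simp add: s_def p_def)
  qed
  then have LR: "?L = ?R"
    using fps_expansion_unique_complex[OF L iffD2[OF has_fps_expansion_cong[OF _ refl] R]] by blast
  have L_nth: "fps_nth ?L n = of_nat (n + 1) * c (n + 1)
      - 2 * (if n < 2 then 0 else of_nat (n - 1) * c (n - 1))
      + (if n < 4 then 0 else of_nat (n - 3) * c (n - 3))" for n
  proof -
    have "?L = fps_deriv ?F - fps_const 2 * (fps_X\<^sup>2 * fps_deriv ?F) + fps_X ^ 4 * fps_deriv ?F"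
      by (simp add: algebra_simps numeral_fps_const)
    then have "fps_nth ?L n = of_nat (n + 1) * c (n + 1)
        - 2 * (if n < 2 then 0 else of_nat (n - 2 + 1) * c (n - 2 + 1))
        + (if n < 4 then 0 else of_nat (n - 4 + 1) * c (n - 4 + 1))"
      by (simp only: fps_X_power_mult_nth c_def fps_add_nth fps_sub_nth fps_mult_left_const_nth
          fps_deriv_nth)
    moreover have "\<not> n < 2 \<Longrightarrow> n - 2 + 1 = n - 1" "\<not> n < 4 \<Longrightarrow> n - 4 + 1 = n - 3"
      by simp_all
    ultimately show ?thesis by (cases "n < 2"; cases "n < 4") simp_all
  qed
  have R_nth: "fps_nth ?R n = p * c n + p * (if n < 2 then 0 else c (n - 2))
      + (1 - s) * (if n < 1 then 0 else c (n - 1)) - (if n < 3 then 0 else c (n - 3))" for n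
  proof -
    have "?R = fps_const p * ?F + fps_const p * (fps_X\<^sup>2 * ?F) + fps_const (1 - s) * (fps_X ^ 1 * ?F)
        - fps_X ^ 3 * ?F"
      by (simp add: algebra_simps fps_const_sub[symmetric] del: fps_const_sub)
    then show ?thesis
      by (simp only: fps_X_power_mult_nth c_def fps_add_nth fps_sub_nth fps_mult_left_const_nth)
  qed
  have *: "of_nat (n + 1) * c (n + 1)
      - 2 * (if n < 2 then 0 else of_nat (n - 1) * c (n - 1))
      + (if n < 4 then 0 else of_nat (n - 3) * c (n - 3))
    = p * c n + p * (if n < 2 then 0 else c (n - 2))
      + (1 - s) * (if n < 1 then 0 else c (n - 1)) - (if n < 3 then 0 else c (n - 3))" for n
    using L_nth[of n] R_nth[of n] LR by simp
  show c0: "c 0 = 1" by (simp add: c_def fps_expansion_def cmehler_def)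
  show "c 1 = p" using *[of 0] c0 by simp
  show "2 * c 2 = p * c 1 + (1 - s) * c 0" using *[of 1] by (simp add: numeral_2_eq_2)
  show "3 * c 3 = p * c 2 + (3 - s) * c 1 + p * c 0" using *[of 2]
    by (simp add: algebra_simps eval_nat_numeral)
  show "of_nat (k + 4) * c (k + 4)
      = p * c (k + 3) + (of_nat (2 * k + 5) - s) * c (k + 2) + p * c (k + 1) - of_nat (k + 1) * c k"
  proof -
    \<comment> \<open>The case distinction concerns only \<open>k = 0\<close>, where the default
      value 0 agrees with the vanishing factor \<open>of_nat k\<close>.\<close>
    have "(if k + 3 < 4 then 0 else of_nat (k + 3 - 3) * c (k + 3 - 3)) = of_nat k * c k"
      by simp
    moreover have "k + 3 + 1 = k + 4" "k + 3 - 2 = k + 1" "k + 3 - 1 = k + 2" "k + 3 - 3 = k"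
      "\<not> k + 3 < 1" "\<not> k + 3 < 2" "\<not> k + 3 < 3"
      by simp_all
    ultimately have "of_nat (k + 4) * c (k + 4) - 2 * (of_nat (k + 2) * c (k + 2)) + of_nat k * c k
      = p * c (k + 3) + p * c (k + 1) + (1 - s) * c (k + 2) - c k"
      using *[of "k + 3"] by (simp only: if_False)
    moreover have "(of_nat (2 * k + 5) :: complex) = 2 * of_nat (k + 2) + 1" "(of_nat (k + 1) :: complex) = of_nat k + 1"
      by simp_all
    ultimately show ?thesis
      by (simp only: eq_diff_eq diff_eq_eq) (simp only: algebra_simps mult_1_left mult_1_right)
  qed
qed

lemma herm_prod_rec:
  defines "m \<equiv> \<lambda>k. herm k u * herm k v" and "s \<equiv> u\<^sup>2 + v\<^sup>2" and "p \<equiv> u * v"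
  shows "m 0 = 1" "m 1 = p" "2 * m 2 = p * m 1 + (1 - s) * m 0"
    "3 * m 3 = p * m 2 + (3 - s) * m 1 + p * m 0"
    "real (k + 4) * m (k + 4)
      = p * m (k + 3) + (real (2 * k + 5) - s) * m (k + 2) + p * m (k + 1) - real (k + 1) * m k"
proof -
  have m: "m k = poly (hermite k) u * poly (hermite k) v / fact k" for k
    by (simp add: m_def herm_def)
  show "m 0 = 1" "m 1 = p" "2 * m 2 = p * m 1 + (1 - s) * m 0"
    "3 * m 3 = p * m 2 + (3 - s) * m 1 + p * m 0"
    by (simp_all add: m poly_hermite_rec numeral_2_eq_2 numeral_3_eq_3 s_def p_def power2_eq_square
        del: hermite.simps(2)) (simp_all add: field_simps)
  define a b where "a k = poly (hermite k) u" and "b k = poly (hermite k) v" for k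
  define r where "r = real k"
  have a: "a (k + 2) = u * a (k + 1) - (r + 1) * a k" "a (k + 3) = u * a (k + 2) - (r + 2) * a (k + 1)"
    "a (k + 4) = u * a (k + 3) - (r + 3) * a (k + 2)"
    using poly_hermite_rec[of k u] poly_hermite_rec[of "k+1" u] poly_hermite_rec[of "k+2" u]
    by (simp_all add: a_def r_def eval_nat_numeral del: hermite.simps)
  have b: "b (k + 2) = v * b (k + 1) - (r + 1) * b k" "b (k + 3) = v * b (k + 2) - (r + 2) * b (k + 1)"
    "b (k + 4) = v * b (k + 3) - (r + 3) * b (k + 2)"
    using poly_hermite_rec[of k v] poly_hermite_rec[of "k+1" v] poly_hermite_rec[of "k+2" v]
    by (simp_all add: b_def r_def eval_nat_numeral del: hermite.simps)
  have f: "fact (k + 1) = (r + 1) * (fact k :: real)" "fact (k + 2) = (r + 2) * (r + 1) * (fact k :: real)"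
    "fact (k + 3) = (r + 3) * (r + 2) * (r + 1) * (fact k :: real)"
    "fact (k + 4) = (r + 4) * (r + 3) * (r + 2) * (r + 1) * (fact k :: real)"
    by (simp_all add: r_def eval_nat_numeral algebra_simps)
  \<comment> \<open>The recurrences reduce both sides to polynomials in \<open>u\<close>,
    \<open>v\<close>, \<open>r\<close> and the values of index \<open>k\<close> and
    \<open>k + 1\<close>. This is the recursion for the products before the factorials are divided
    out.\<close>
  have AA: "a (k + 4) * b (k + 4) = p * (a (k + 3) * b (k + 3)) + (2 * r + 5 - s) * (r + 3) * (a (k + 2) * b (k + 2))
     + p * (r + 3) * (r + 2) * (a (k + 1) * b (k + 1)) - (r + 1)\<^sup>2 * (r + 2) * (r + 3) * (a k * b k)"
    unfolding a b s_def p_def by algebra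
  have m4: "real (k + 4) * m (k + 4) = a (k + 4) * b (k + 4) / ((r + 3) * (r + 2) * (r + 1) * fact k)"
  proof -
    have r4: "real (k + 4) = r + 4" "r + 4 \<noteq> 0" by (simp_all add: r_def)
    have "(r + 4) * (Y / ((r + 4) * (r + 3) * (r + 2) * (r + 1) * F))
        = Y / ((r + 3) * (r + 2) * (r + 1) * F)" for Y F
      using r4(2) by (simp add: mult.assoc)
    then show ?thesis by (simp only: m f a_def b_def r4(1))
  qed
  have ne: "r + 3 \<noteq> 0" "r + 2 \<noteq> 0" "r + 1 \<noteq> 0" by (simp_all add: r_def add_nonneg_eq_0_iff)
  have gen: "(p * A3 + (2 * r + 5 - s) * (r + 3) * A2 + p * (r + 3) * (r + 2) * A1
      - (r + 1)\<^sup>2 * (r + 2) * (r + 3) * A0) / ((r + 3) * (r + 2) * (r + 1) * F)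
    = p * (A3 / ((r + 3) * (r + 2) * (r + 1) * F)) + (2 * r + 5 - s) * (A2 / ((r + 2) * (r + 1) * F))
      + p * (A1 / ((r + 1) * F)) - (r + 1) * (A0 / F)" if "F \<noteq> 0" for A3 A2 A1 A0 F
    using ne that by (simp add: divide_simps power2_eq_square)
  have rk: "real (2 * k + 5) = 2 * r + 5" "real (k + 1) = r + 1" by (simp_all add: r_def)
  show "real (k + 4) * m (k + 4)
      = p * m (k + 3) + (real (2 * k + 5) - s) * m (k + 2) + p * m (k + 1) - real (k + 1) * m k"
    unfolding m4 AA gen[OF fact_nonzero] rk by (simp only: m f a_def b_def)
qed

lemma cmehler_coeff: "fps_nth (fps_expansion cmehler 0) n = of_real (herm n u * herm n v)"
proof (induction n rule: less_induct)
  case (less n)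
  note c = cmehler_coeff_rec
  note m = herm_prod_rec
  \<comment> \<open>The recursions determine a coefficient only after multiplication by its index;
    writing that index as a successor shows that it can be cancelled.\<close>
  have cancel: "x = y" if "of_nat (Suc j) * x = complex_of_real (real (Suc j)) * y" for x y :: complex and j
    using that by (simp del: of_nat_Suc)
  consider "n = 0" | "n = 1" | "n = 2" | "n = 3" | k where "n = k + 4"
  proof (cases "n < 4")
    case False
    then show ?thesis using that(5)[of "n - 4"] by simp
  qed (use that in linarith)
  then show ?case
  proof cases
    case 1
    then show ?thesis by (simp only: c m of_real_1)
  next
    case 2
    then show ?thesis by (simp only: c m)
  next
    case 3
    have "of_nat (Suc 1) * fps_nth (fps_expansion cmehler 0) 2 = of_real (real (Suc 1) * (herm 2 u * herm 2 v))"
      using less[of 0] less[of 1] c(3) arg_cong[OF m(3), of complex_of_real] by (simp add: 3)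
    from cancel[OF this[unfolded of_real_mult[of "real _"]]] show ?thesis by (simp only: 3)
  next
    case 4
    have "of_nat (Suc 2) * fps_nth (fps_expansion cmehler 0) 3 = of_real (real (Suc 2) * (herm 3 u * herm 3 v))"
      using less[of 0] less[of 1] less[of 2] c(4) arg_cong[OF m(4), of complex_of_real] by (simp add: 4)
    from cancel[OF this[unfolded of_real_mult[of "real _"]]] show ?thesis by (simp only: 4)
  next
    case 5
    have eq: "k + 4 = Suc (k + 3)" by simp
    have "of_nat (k + 4) * fps_nth (fps_expansion cmehler 0) (k + 4)
        = of_real (real (k + 4) * (herm (k + 4) u * herm (k + 4) v))"
      unfolding c(5) m(5) using less[of k] less[of "k + 1"] less[of "k + 2"] less[of "k + 3"]
      by (simp add: 5)
    from cancel[OF this[unfolded of_real_mult[of "real _"] eq]] show ?thesis by (simp only: 5 eq)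
  qed
qed

theorem mehler_sums:
  assumes "\<bar>z\<bar> < 1"
  shows "(\<lambda>n. z ^ n * (herm n u * herm n v)) sums mehler z u v"
    and "summable (\<lambda>n. norm (z ^ n * (herm n u * herm n v)))"
proof -
  have F: "cmehler has_fps_expansion fps_expansion cmehler 0"
    by (rule has_fps_expansion_fps_expansion[OF _ _ cmehler_holomorphic]) auto
  have *: "(\<lambda>n. fps_nth (fps_expansion cmehler 0) n * w ^ n) sums cmehler w" if "norm w < 1" for w
    using has_fps_expansion_imp_sums_complex[OF F, of 1 w] cmehler_holomorphic that by (simp add: one_ereal_def)
  have S: "(\<lambda>n. complex_of_real (x ^ n * (herm n u * herm n v))) sums of_real (mehler x u v)" if "\<bar>x\<bar> < 1" for x
  proof -
    have "0 \<le> 1 - x\<^sup>2" using that by (simp add: abs_square_le_1)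
    from of_real_sqrt[OF this]
    have "csqrt (1 - (of_real x)\<^sup>2) = of_real (sqrt (1 - x\<^sup>2))"
      by simp
    moreover have "(of_real x * of_real (u * v) - (of_real x)\<^sup>2 * of_real (u\<^sup>2 + v\<^sup>2) / 2) / (1 - (of_real x)\<^sup>2)
        = complex_of_real ((x * u * v - x\<^sup>2 * (u\<^sup>2 + v\<^sup>2) / 2) / (1 - x\<^sup>2))"
      by (simp add: mult.assoc)
    ultimately have "cmehler (of_real x) = of_real (mehler x u v)"
      unfolding cmehler_def mehler_def
      by (simp only: of_real_divide[of "exp _" "sqrt _"] exp_of_real)
    then show ?thesis using *[of "of_real x"] that by (simp add: cmehler_coeff mult_ac)
  qed
  show "(\<lambda>n. z ^ n * (herm n u * herm n v)) sums mehler z u v"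
    using S[OF assms] by (simp only: sums_of_real_iff)
  \<comment> \<open>Convergence at a point strictly between \<bar>z\<bar> and 1 gives absolute
    convergence at \<open>z\<close>.\<close>
  obtain x where x: "\<bar>z\<bar> < x" "x < 1" using dense[OF assms] by auto
  have "summable (\<lambda>n. herm n u * herm n v * x ^ n)"
    using S[of x] x unfolding sums_of_real_iff by (auto simp: sums_iff mult_ac)
  from powser_insidea[OF this, of z] x show "summable (\<lambda>n. norm (z ^ n * (herm n u * herm n v)))"
    by (simp add: mult_ac)
qed

end

section \<open>The dual activation as a power series\<close>

lemma borel_measurable_mehler [measurable]:
  "(\<lambda>p. mehler z (fst p) (snd p)) \<in> borel_measurable (borel \<Otimes>\<^sub>M borel)"
  "mehler z u \<in> borel_measurable borel"
  unfolding mehler_def[abs_def] by measurable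

lemma mehler_nonneg: "\<bar>z\<bar> < 1 \<Longrightarrow> 0 \<le> mehler z u v"
  by (simp add: mehler_def abs_square_le_1)

text \<open>Given the first coordinate \<open>u\<close>, the second is normal with mean z u and
  variance 1 - z^2. Completing the square turns its density into the standard one times Mehler's
  kernel.\<close>

lemma normal_density_mehler:
  assumes "\<bar>z\<bar> < 1"
  shows "normal_density (z * u) (sqrt (1 - z\<^sup>2)) v = std_normal_density v * mehler z u v"
proof -
  define w where "w = 1 - z\<^sup>2"
  have w: "w > 0" using assms by (simp add: w_def abs_square_less_1)
  have "- (v - z * u)\<^sup>2 / (2 * w) = - v\<^sup>2 / 2 + (z * u * v - z\<^sup>2 * (u\<^sup>2 + v\<^sup>2) / 2) / w"
  proof -
    have "- (v - z * u)\<^sup>2 = - v\<^sup>2 * w + (z * u * v - z\<^sup>2 * (u\<^sup>2 + v\<^sup>2) / 2) * 2"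
      by (simp add: w_def power2_eq_square algebra_simps)
    then show ?thesis using w by (simp add: field_simps)
  qed
  then show ?thesis
    using w by (simp add: normal_density_def mehler_def w_def[symmetric] real_sqrt_mult
        flip: exp_add)
qed

text \<open>The substitution v = z u + sqrt (1 - z^2) h. The nonnegative integral asks for
  measurability alone, so that indicators can be inserted to identify measures.\<close>

lemma nn_integral_gauss_affine:
  assumes z: "\<bar>z\<bar> < 1" and f [measurable]: "f \<in> borel_measurable borel"
  shows "(\<integral>\<^sup>+h. f (z * u + sqrt (1 - z\<^sup>2) * h) \<partial>gauss) = (\<integral>\<^sup>+v. ennreal (mehler z u v) * f v \<partial>gauss)"
proof -
  define s where "s = sqrt (1 - z\<^sup>2)"
  have s: "s > 0" using z by (simp add: s_def abs_square_less_1)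
  have "(\<integral>\<^sup>+v. ennreal (mehler z u v) * f v \<partial>gauss)
      = (\<integral>\<^sup>+v. ennreal (std_normal_density v * mehler z u v) * f v \<partial>lborel)"
    by (subst nn_integral_density) (auto simp: ennreal_mult mehler_nonneg z mult_ac)
  also have "\<dots> = (\<integral>\<^sup>+v. ennreal (normal_density (z * u) s v) * f v \<partial>lborel)"
    by (simp add: normal_density_mehler[OF z] s_def)
  also have "\<dots> = \<bar>s\<bar> * (\<integral>\<^sup>+h. ennreal (normal_density (z * u) s (z * u + s * h)) * f (z * u + s * h) \<partial>lborel)"
    using s by (intro nn_integral_real_affine) auto
  also have "\<dots> = (\<integral>\<^sup>+h. ennreal \<bar>s\<bar> * (ennreal (normal_density (z * u) s (z * u + s * h)) * f (z * u + s * h)) \<partial>lborel)"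
    by (rule nn_integral_cmult[symmetric]) auto
  also have "\<dots> = (\<integral>\<^sup>+h. ennreal (std_normal_density h) * f (z * u + s * h) \<partial>lborel)"
  proof (intro nn_integral_cong)
    fix h
    have "s * normal_density (z * u) s (z * u + s * h) = std_normal_density h"
      using s by (simp add: normal_density_def real_sqrt_mult power_mult_distrib real_sqrt_abs)
    then show "ennreal \<bar>s\<bar> * (ennreal (normal_density (z * u) s (z * u + s * h)) * f (z * u + s * h))
        = ennreal (std_normal_density h) * f (z * u + s * h)"
      using s by (simp add: mult.assoc[symmetric] flip: ennreal_mult)
  qed
  also have "\<dots> = (\<integral>\<^sup>+h. f (z * u + s * h) \<partial>gauss)"
    by (subst nn_integral_density) auto
  finally show ?thesis by (simp add: s_def)
qed

lemma gaussian_pair_measurable [measurable]: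
  "(\<lambda>(g, h). (g, z * g + sqrt (1 - z\<^sup>2) * h)) \<in> gauss \<Otimes>\<^sub>M gauss \<rightarrow>\<^sub>M borel"
proof -
  have "(\<lambda>(g, h). (g, z * g + sqrt (1 - z\<^sup>2) * h)) \<in> gauss \<Otimes>\<^sub>M gauss \<rightarrow>\<^sub>M borel \<Otimes>\<^sub>M borel"
    by measurable
  then show ?thesis by (simp add: borel_prod)
qed

text \<open>Fubini fixes the first coordinate and leaves the affine substitution in the second. At
  \<bar>z\<bar> = 1 the law is concentrated on a line and has no such density.\<close>

lemma gaussian_pair_eq_density:
  assumes z: "\<bar>z\<bar> < 1"
  shows "gaussian_pair z = density (gauss \<Otimes>\<^sub>M gauss) (\<lambda>p. ennreal (mehler z (fst p) (snd p)))"
proof (rule measure_eqI)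
  have sets2: "sets (gauss \<Otimes>\<^sub>M gauss) = sets (borel :: (real \<times> real) measure)"
    by (simp add: borel_prod[symmetric] cong: sets_pair_measure_cong)
  then show "sets (gaussian_pair z)
      = sets (density (gauss \<Otimes>\<^sub>M gauss) (\<lambda>p. ennreal (mehler z (fst p) (snd p))))"
    by (simp add: gaussian_pair_def)
  fix A assume "A \<in> sets (gaussian_pair z)"
  then have A [measurable]: "A \<in> sets (borel \<Otimes>\<^sub>M borel)"
    by (simp add: gaussian_pair_def flip: borel_prod)
  then have A' [measurable]: "A \<in> sets (gauss \<Otimes>\<^sub>M gauss)" "A \<in> sets borel"
    by (simp_all add: sets2 flip: borel_prod)
  have "emeasure (gaussian_pair z) A
      = (\<integral>\<^sup>+p. indicator A (fst p, z * fst p + sqrt (1 - z\<^sup>2) * snd p) \<partial>(gauss \<Otimes>\<^sub>M gauss))"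
  proof -
    have "emeasure (gaussian_pair z) A = (\<integral>\<^sup>+q. indicator A q \<partial>gaussian_pair z)"
      by (simp add: gaussian_pair_def)
    also have "\<dots> = (\<integral>\<^sup>+p. indicator A ((\<lambda>(g, h). (g, z * g + sqrt (1 - z\<^sup>2) * h)) p) \<partial>(gauss \<Otimes>\<^sub>M gauss))"
      unfolding gaussian_pair_def by (rule nn_integral_distr) auto
    finally show ?thesis by (simp add: split_beta)
  qed
  also have "\<dots> = (\<integral>\<^sup>+u. \<integral>\<^sup>+h. indicator A (u, z * u + sqrt (1 - z\<^sup>2) * h) \<partial>gauss \<partial>gauss)"
    by (subst gauss.nn_integral_fst[symmetric]) auto
  also have "\<dots> = (\<integral>\<^sup>+u. \<integral>\<^sup>+v. ennreal (mehler z u v) * indicator A (u, v) \<partial>gauss \<partial>gauss)"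
    by (intro nn_integral_cong nn_integral_gauss_affine[OF z]) measurable
  also have "\<dots> = (\<integral>\<^sup>+p. ennreal (mehler z (fst p) (snd p)) * indicator A p \<partial>(gauss \<Otimes>\<^sub>M gauss))"
    by (subst gauss.nn_integral_fst[symmetric]) auto
  also have "\<dots> = emeasure (density (gauss \<Otimes>\<^sub>M gauss) (\<lambda>p. ennreal (mehler z (fst p) (snd p)))) A"
    by (subst emeasure_density) auto
  finally show "emeasure (gaussian_pair z) A
      = emeasure (density (gauss \<Otimes>\<^sub>M gauss) (\<lambda>p. ennreal (mehler z (fst p) (snd p)))) A" .
qed

lemma gauss_pair_product:
  fixes a b :: "real \<Rightarrow> real"
  assumes [measurable]: "integrable gauss a" "integrable gauss b"
  shows "integrable (gauss \<Otimes>\<^sub>M gauss) (\<lambda>p. a (fst p) * b (snd p))"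
    and "(LINT p|(gauss \<Otimes>\<^sub>M gauss). a (fst p) * b (snd p)) = (LINT x|gauss. a x) * (LINT x|gauss. b x)"
proof -
  show *: "integrable (gauss \<Otimes>\<^sub>M gauss) (\<lambda>p. a (fst p) * b (snd p))"
    by (rule gauss2.Fubini_integrable) (auto simp: abs_mult assms)
  show "(LINT p|(gauss \<Otimes>\<^sub>M gauss). a (fst p) * b (snd p)) = (LINT x|gauss. a x) * (LINT x|gauss. b x)"
    using gauss2.integral_fst'[OF *] by simp
qed

text \<open>Mehler's series is integrated term by term against f(u) f(v); every term splits into a
  product of two equal one-dimensional integrals, whence the square.\<close>

lemma dual_activation_sums:
  assumes f: "square_int f" and z: "\<bar>z\<bar> < 1"
  shows "(\<lambda>k. (hcoeff f k)\<^sup>2 * z ^ k) sums dual_activation f z"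
proof -
  have [measurable]: "f \<in> borel_measurable borel" using f by (simp add: square_int_def)
  let ?P = "gauss \<Otimes>\<^sub>M gauss"
  define F where "F k p = z ^ k * ((f (fst p) * herm k (fst p)) * (f (snd p) * herm k (snd p)))"
    for k and p :: "real \<times> real"
  have int: "integrable gauss (\<lambda>x. f x * herm k x)" for k
    by (rule square_int_mult[OF f square_int_herm])
  have "dual_activation f z = (LINT p|?P. mehler z (fst p) (snd p) * (f (fst p) * f (snd p)))"
    unfolding dual_activation_def gaussian_pair_eq_density[OF z]
    by (subst integral_density) (auto simp: mehler_nonneg z)
  also have "\<dots> = (LINT p|?P. (\<Sum>k. F k p))"
  proof (rule Bochner_Integration.integral_cong[OF refl])
    fix p :: "real \<times> real"
    have "(\<lambda>k. z ^ k * (herm k (fst p) * herm k (snd p)) * (f (fst p) * f (snd p)))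
        sums (mehler z (fst p) (snd p) * (f (fst p) * f (snd p)))"
      by (intro sums_mult2 mehler_sums z)
    then show "mehler z (fst p) (snd p) * (f (fst p) * f (snd p)) = (\<Sum>k. F k p)"
      by (simp add: sums_iff F_def mult_ac)
  qed
  finally have 1: "dual_activation f z = (LINT p|?P. (\<Sum>k. F k p))" .
  have F_int: "(LINT p|?P. F k p) = (hcoeff f k)\<^sup>2 * z ^ k" for k
    by (simp add: F_def gauss_pair_product[OF int int] hcoeff_def power2_eq_square)
  \<comment> \<open>The Hermite functions have unit norm, so the arithmetic-geometric bound on E
    \<bar>f h_k\<bar> does not depend on \<open>k\<close>, and the norms are dominated by a
    geometric series.\<close>
  have F_norm: "(LINT p|?P. norm (F k p)) \<le> \<bar>z\<bar> ^ k * (((LINT x|gauss. (f x)\<^sup>2) + 1) / 2)\<^sup>2" for k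
  proof -
    have "(LINT x|gauss. \<bar>f x * herm k x\<bar>) \<le> (LINT x|gauss. ((f x)\<^sup>2 + (herm k x)\<^sup>2) / 2)"
      using f square_int_herm[of k]
      by (intro integral_mono integrable_abs int abs_mult_le_squares) (simp add: square_int_def)
    also have "\<dots> = ((LINT x|gauss. (f x)\<^sup>2) + 1) / 2"
      using f square_int_herm[of k] herm_orthonormal[of k k]
      by (simp add: square_int_def power2_eq_square)
    finally have "(LINT x|gauss. \<bar>f x * herm k x\<bar>)\<^sup>2 \<le> (((LINT x|gauss. (f x)\<^sup>2) + 1) / 2)\<^sup>2"
      by (intro power_mono integral_nonneg_AE) auto
    moreover have "(LINT p|?P. norm (F k p)) = \<bar>z\<bar> ^ k * (LINT x|gauss. \<bar>f x * herm k x\<bar>)\<^sup>2"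
    proof -
      have "(LINT p|?P. norm (F k p))
          = (LINT p|?P. \<bar>z\<bar> ^ k * (\<bar>f (fst p) * herm k (fst p)\<bar> * \<bar>f (snd p) * herm k (snd p)\<bar>))"
        by (intro Bochner_Integration.integral_cong) (simp_all add: F_def abs_mult power_abs)
      also have "\<dots> = \<bar>z\<bar> ^ k * (LINT x|gauss. \<bar>f x * herm k x\<bar>)\<^sup>2"
        by (simp only: integral_mult_right_zero gauss_pair_product[OF integrable_abs[OF int] integrable_abs[OF int]]
            power2_eq_square)
      finally show ?thesis .
    qed
    ultimately show ?thesis by (simp add: mult_left_mono)
  qed
  have "(\<lambda>k. LINT p|?P. F k p) sums (LINT p|?P. (\<Sum>k. F k p))"
  proof (rule sums_integral)
    show "integrable ?P (F k)" for k
      unfolding F_def[abs_def] by (intro integrable_mult_right gauss_pair_product int)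
    show "AE p in ?P. summable (\<lambda>k. norm (F k p))"
    proof (intro AE_I2)
      fix p
      have "summable (\<lambda>k. norm (z ^ k * (herm k (fst p) * herm k (snd p))) * \<bar>f (fst p) * f (snd p)\<bar>)"
        by (intro summable_mult2 mehler_sums z)
      then show "summable (\<lambda>k. norm (F k p))"
        by (simp add: F_def abs_mult mult_ac)
    qed
    show "summable (\<lambda>k. LINT p|?P. norm (F k p))"
    proof (rule summable_comparison_test')
      show "summable (\<lambda>k. \<bar>z\<bar> ^ k * (((LINT x|gauss. (f x)\<^sup>2) + 1) / 2)\<^sup>2)"
        using z by (intro summable_mult2 summable_geometric) simp
      show "norm (LINT p|?P. norm (F k p)) \<le> \<bar>z\<bar> ^ k * (((LINT x|gauss. (f x)\<^sup>2) + 1) / 2)\<^sup>2" for k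
        using F_norm[of k] by (simp add: integral_nonneg_AE)
    qed
  qed
  then show ?thesis by (simp add: 1 F_int)
qed

section \<open>Parseval's identity\<close>

definition bessel_defect :: "(real \<Rightarrow> real) \<Rightarrow> real" where
  "bessel_defect f = (LINT x|gauss. (f x)\<^sup>2) - (\<Sum>k. (hcoeff f k)\<^sup>2)"

text \<open>The defect is a nonnegative quadratic form bounded by the squared norm, so it vanishes as
  soon as it vanishes on a dense set. For bounded continuous \<open>g\<close> it does, because
  \<open>dual_activation g z\<close> tends to \<open>E g\<^sup>2\<close> as \<open>z \<rightarrow> 1\<close>.\<close>

lemma bessel_defect_nonneg: "square_int f \<Longrightarrow> 0 \<le> bessel_defect f"
  using suminf_hcoeff_le by (simp add: bessel_defect_def)

lemma bessel_defect_le: "square_int f \<Longrightarrow> bessel_defect f \<le> (LINT x|gauss. (f x)\<^sup>2)"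
  by (simp add: bessel_defect_def suminf_nonneg summable_hcoeff)

text \<open>Applied to \<open>g\<close> and \<open>f - g\<close>, with the second summand on the
  left dropped as nonnegative, it bounds the defect of \<open>f\<close> by those of an approximant
  and of the error, without any inner product.\<close>

lemma bessel_defect_parallelogram:
  assumes "square_int f" "square_int g"
  shows "bessel_defect (\<lambda>x. f x + g x) + bessel_defect (\<lambda>x. f x - g x)
    = 2 * bessel_defect f + 2 * bessel_defect g"
proof -
  note sq = assms square_int_add[OF assms] square_int_diff[OF assms]
  have "(LINT x|gauss. (f x + g x)\<^sup>2) + (LINT x|gauss. (f x - g x)\<^sup>2)
      = (LINT x|gauss. (f x + g x)\<^sup>2 + (f x - g x)\<^sup>2)"
    using sq by (simp add: square_int_def)
  also have "\<dots> = (LINT x|gauss. 2 * (f x)\<^sup>2 + 2 * (g x)\<^sup>2)"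
    by (simp add: power2_eq_square algebra_simps)
  also have "\<dots> = 2 * (LINT x|gauss. (f x)\<^sup>2) + 2 * (LINT x|gauss. (g x)\<^sup>2)"
    using sq by (simp add: square_int_def)
  finally have 1: "(LINT x|gauss. (f x + g x)\<^sup>2) + (LINT x|gauss. (f x - g x)\<^sup>2)
      = 2 * (LINT x|gauss. (f x)\<^sup>2) + 2 * (LINT x|gauss. (g x)\<^sup>2)" .
  have "(\<Sum>k. (hcoeff (\<lambda>x. f x + g x) k)\<^sup>2) + (\<Sum>k. (hcoeff (\<lambda>x. f x - g x) k)\<^sup>2)
      = (\<Sum>k. (hcoeff f k + hcoeff g k)\<^sup>2 + (hcoeff f k - hcoeff g k)\<^sup>2)"
    using suminf_add[OF summable_hcoeff[OF sq(3)] summable_hcoeff[OF sq(4)]]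
    by (simp add: hcoeff_add hcoeff_diff assms)
  also have "\<dots> = (\<Sum>k. 2 * (hcoeff f k)\<^sup>2 + 2 * (hcoeff g k)\<^sup>2)"
    by (simp add: power2_eq_square algebra_simps)
  also have "\<dots> = 2 * (\<Sum>k. (hcoeff f k)\<^sup>2) + 2 * (\<Sum>k. (hcoeff g k)\<^sup>2)"
    using summable_hcoeff[OF assms(1)] summable_hcoeff[OF assms(2)]
    by (simp add: suminf_add[symmetric] suminf_mult summable_mult)
  finally show ?thesis using 1 by (simp add: bessel_defect_def)
qed

lemma dual_activation_eq:
  assumes [measurable]: "f \<in> borel_measurable borel"
  shows "dual_activation f z
    = (LINT p|(gauss \<Otimes>\<^sub>M gauss). f (fst p) * f (z * fst p + sqrt (1 - z\<^sup>2) * snd p))"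
proof -
  have [measurable]: "(\<lambda>p. f (fst p) * f (snd p)) \<in> borel_measurable borel"
    unfolding borel_prod[symmetric] by measurable
  show ?thesis
    unfolding dual_activation_def gaussian_pair_def
    by (subst integral_distr) (auto simp: split_beta)
qed

lemma gauss_pair_fst:
  assumes "integrable gauss (a :: real \<Rightarrow> real)"
  shows "(LINT p|(gauss \<Otimes>\<^sub>M gauss). a (fst p)) = (LINT x|gauss. a x)"
  using gauss_pair_product(2)[OF assms, of "\<lambda>_. 1"] gauss.prob_space by simp

lemma dual_activation_one:
  assumes "square_int f"
  shows "dual_activation f 1 = (LINT x|gauss. (f x)\<^sup>2)"
  using assms gauss_pair_fst[of "\<lambda>x. (f x)\<^sup>2"]
  by (simp add: square_int_def dual_activation_eq power2_eq_square)

lemma bounded_square_int: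
  assumes [measurable]: "f \<in> borel_measurable borel" and "\<And>x. \<bar>f x\<bar> \<le> B"
  shows "square_int f"
proof -
  have "integrable gauss (\<lambda>x. (f x)\<^sup>2)"
  proof (rule gauss.integrable_const_bound[where B = "B\<^sup>2"])
    show "AE x in gauss. norm ((f x)\<^sup>2) \<le> B\<^sup>2"
      using assms(2) by (intro AE_I2) (simp add: abs_le_square_iff[symmetric] order_trans[OF _ abs_ge_self])
  qed simp
  then show ?thesis by (simp add: square_int_def)
qed

text \<open>Abel's argument: each series value at z < 1 is at most the full sum of the coefficients,
  hence so is the limit E g^2, and Bessel gives the converse. Continuity provides pointwise
  convergence of the integrand, boundedness a constant that dominates it.\<close>

lemma bessel_defect_continuous:
  assumes cont: "continuous_on UNIV g" and bound: "\<And>x. \<bar>g x\<bar> \<le> B"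
  shows "bessel_defect g = 0"
proof -
  have [measurable]: "g \<in> borel_measurable borel"
    using cont by (rule borel_measurable_continuous_onI)
  have sq: "square_int g" by (rule bounded_square_int[OF _ bound]) simp
  define z where "z n = 1 - 1 / real (n + 2)" for n
  have z: "0 \<le> z n" "z n < 1" for n
    by (simp_all add: z_def)
  have z_lim: "z \<longlonglongrightarrow> 1"
    unfolding z_def by real_asymp
  have "(\<lambda>n. dual_activation g (z n)) \<longlonglongrightarrow> (LINT p|(gauss \<Otimes>\<^sub>M gauss). (g (fst p))\<^sup>2)"
    unfolding dual_activation_eq[OF \<open>g \<in> borel_measurable borel\<close>]
  proof (rule integral_dominated_convergence[where w = "\<lambda>_. B\<^sup>2"])
    show "AE p in gauss \<Otimes>\<^sub>M gauss. (\<lambda>n. g (fst p) * g (z n * fst p + sqrt (1 - (z n)\<^sup>2) * snd p))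
        \<longlonglongrightarrow> (g (fst p))\<^sup>2"
    proof (intro AE_I2)
      fix p :: "real \<times> real"
      have "(\<lambda>n. z n * fst p + sqrt (1 - (z n)\<^sup>2) * snd p) \<longlonglongrightarrow> 1 * fst p + sqrt (1 - 1\<^sup>2) * snd p"
        by (intro tendsto_intros z_lim)
      then have "(\<lambda>n. g (z n * fst p + sqrt (1 - (z n)\<^sup>2) * snd p)) \<longlonglongrightarrow> g (fst p)"
        using cont by (auto intro: continuous_on_tendsto_compose)
      then show "(\<lambda>n. g (fst p) * g (z n * fst p + sqrt (1 - (z n)\<^sup>2) * snd p)) \<longlonglongrightarrow> (g (fst p))\<^sup>2"
        unfolding power2_eq_square by (intro tendsto_intros)
    qed
    show "AE p in gauss \<Otimes>\<^sub>M gauss.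
        norm (g (fst p) * g (z n * fst p + sqrt (1 - (z n)\<^sup>2) * snd p)) \<le> B\<^sup>2" for n
      using bound by (intro AE_I2) (auto simp: abs_mult power2_eq_square intro!: mult_mono order_trans[OF abs_ge_zero bound])
  qed auto
  moreover have "dual_activation g (z n) \<le> (\<Sum>k. (hcoeff g k)\<^sup>2)" for n
  proof -
    have s: "(\<lambda>k. (hcoeff g k)\<^sup>2 * z n ^ k) sums dual_activation g (z n)"
      using z[of n] by (intro dual_activation_sums sq) simp
    have "(\<Sum>k. (hcoeff g k)\<^sup>2 * z n ^ k) \<le> (\<Sum>k. (hcoeff g k)\<^sup>2)"
      using z[of n] s by (intro suminf_le summable_hcoeff sq)
        (auto simp: sums_iff power_le_one mult_left_le)
    then show ?thesis using s by (simp add: sums_iff)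
  qed
  ultimately have "(LINT p|(gauss \<Otimes>\<^sub>M gauss). (g (fst p))\<^sup>2) \<le> (\<Sum>k. (hcoeff g k)\<^sup>2)"
    by (intro LIMSEQ_le_const2) auto
  then show ?thesis
    using bessel_defect_nonneg[OF sq] sq
    by (subst (asm) gauss_pair_fst) (auto simp: bessel_defect_def square_int_def)
qed

section \<open>Approximation by bounded continuous functions\<close>

definition clip :: "real \<Rightarrow> real \<Rightarrow> real" where
  "clip m x = max (- m) (min m x)"

lemma clip_bound: "0 \<le> m \<Longrightarrow> \<bar>clip m x\<bar> \<le> m"
  and clip_diff_bound: "0 \<le> m \<Longrightarrow> \<bar>x - clip m x\<bar> \<le> \<bar>x\<bar>"
  and clip_eq: "\<bar>x\<bar> \<le> m \<Longrightarrow> clip m x = x"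
  by (auto simp: clip_def)

lemma continuous_on_clip: "continuous_on UNIV h \<Longrightarrow> continuous_on UNIV (\<lambda>x. clip m (h x))"
  unfolding clip_def by (intro continuous_intros)

lemma borel_measurable_clip [measurable]: "clip m \<in> borel_measurable borel"
  unfolding clip_def[abs_def] by measurable

text \<open>Truncation makes \<open>f\<close> bounded; the truncated function is an almost
  everywhere limit of continuous functions, which are clipped at the same level so that a constant
  dominates. The two errors of size \<open>e / 4\<close> combine through (a + b)^2 \<le> 2 a^2 + 2
  b^2.\<close>

lemma square_int_approx:
  assumes f: "square_int f" and e: "0 < e"
  obtains g B where "continuous_on UNIV g" "\<And>x. \<bar>g x\<bar> \<le> B"
    "(LINT x|gauss. (f x - g x)\<^sup>2) < e"
proof -
  have [measurable]: "f \<in> borel_measurable borel" and f2: "integrable gauss (\<lambda>x. (f x)\<^sup>2)"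
    using f by (auto simp: square_int_def)
  have "(\<lambda>m. LINT x|gauss. (f x - clip (real m) (f x))\<^sup>2) \<longlonglongrightarrow> (LINT x|gauss. 0)"
  proof (rule integral_dominated_convergence[where w = "\<lambda>x. (f x)\<^sup>2"])
    show "AE x in gauss. (\<lambda>m. (f x - clip (real m) (f x))\<^sup>2) \<longlonglongrightarrow> 0"
    proof (intro AE_I2 tendsto_eventually)
      fix x
      show "eventually (\<lambda>m. (f x - clip (real m) (f x))\<^sup>2 = 0) sequentially"
        using eventually_ge_at_top[of "nat \<lceil>\<bar>f x\<bar>\<rceil>"] by eventually_elim (simp add: clip_eq)
    qed
    show "AE x in gauss. norm ((f x - clip (real m) (f x))\<^sup>2) \<le> (f x)\<^sup>2" for m
      by (intro AE_I2) (simp add: abs_le_square_iff[symmetric] clip_diff_bound)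
  qed (use f2 in auto)
  then have "eventually (\<lambda>m. (LINT x|gauss. (f x - clip (real m) (f x))\<^sup>2) < e / 4) sequentially"
    using e by (intro order_tendstoD) auto
  then obtain m :: nat where m: "(LINT x|gauss. (f x - clip (real m) (f x))\<^sup>2) < e / 4"
    by (auto dest: eventually_happens)
  have "f \<in> borel_measurable lebesgue"
    by (simp add: measurable_completion)
  then have "f measurable_on UNIV"
    by (intro lebesgue_measurable_imp_measurable_on) auto
  then obtain N h where N: "negligible N" and h: "\<And>n. continuous_on UNIV (h n :: real \<Rightarrow> real)"
    and lim: "\<And>x. x \<notin> N \<Longrightarrow> (\<lambda>n. h n x) \<longlonglongrightarrow> f x"
    unfolding measurable_on_def by auto
  have [measurable]: "h n \<in> borel_measurable borel" for n
    using h by (rule borel_measurable_continuous_onI)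
  have "AE x in lborel. x \<notin> N"
    using N by (metis AE_completion_iff AE_not_in negligible_iff_null_sets)
  \<comment> \<open>The Gaussian law has a density with respect to Lebesgue measure, so the
    exceptional null set remains null.\<close>
  then have AE_N: "AE x in gauss. x \<notin> N"
    by (subst AE_density) auto
  have "(\<lambda>n. LINT x|gauss. (clip m (f x) - clip m (h n x))\<^sup>2) \<longlonglongrightarrow> (LINT x|gauss. 0)"
  proof (rule integral_dominated_convergence[where w = "\<lambda>x. (2 * real m)\<^sup>2"])
    show "AE x in gauss. (\<lambda>n. (clip m (f x) - clip m (h n x))\<^sup>2) \<longlonglongrightarrow> 0"
      using AE_N
    proof eventually_elim
      case (elim x)
      have "(\<lambda>n. (clip m (f x) - clip m (h n x))\<^sup>2) \<longlonglongrightarrow> (clip m (f x) - clip m (f x))\<^sup>2"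
        unfolding clip_def by (intro tendsto_intros lim elim)
      then show ?case by simp
    qed
    show "AE x in gauss. norm ((clip m (f x) - clip m (h n x))\<^sup>2) \<le> (2 * real m)\<^sup>2" for n
    proof (intro AE_I2)
      fix x
      have "\<bar>clip m (f x) - clip m (h n x)\<bar> \<le> \<bar>2 * real m\<bar>"
        using clip_bound[of m "f x"] clip_bound[of m "h n x"] by linarith
      then show "norm ((clip m (f x) - clip m (h n x))\<^sup>2) \<le> (2 * real m)\<^sup>2"
        by (simp only: abs_le_square_iff) simp
    qed
  qed auto
  then have "eventually (\<lambda>n. (LINT x|gauss. (clip m (f x) - clip m (h n x))\<^sup>2) < e / 4) sequentially"
    using e by (intro order_tendstoD) auto
  then obtain n where n: "(LINT x|gauss. (clip m (f x) - clip m (h n x))\<^sup>2) < e / 4"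
    by (auto dest: eventually_happens)
  define g where "g x = clip m (h n x)" for x
  have sq: "square_int (\<lambda>x. clip m (f x))" "square_int g"
    unfolding g_def by (rule bounded_square_int[OF _ clip_bound]; simp)+
  note ints = square_int_diff[OF f sq(1)] square_int_diff[OF sq] square_int_diff[OF f sq(2)]
  have "(LINT x|gauss. (f x - g x)\<^sup>2)
      \<le> (LINT x|gauss. 2 * (f x - clip m (f x))\<^sup>2 + 2 * (clip m (f x) - g x)\<^sup>2)"
  proof (rule integral_mono)
    fix x
    have "0 \<le> ((f x - clip m (f x)) - (clip m (f x) - g x))\<^sup>2" by simp
    then show "(f x - g x)\<^sup>2 \<le> 2 * (f x - clip m (f x))\<^sup>2 + 2 * (clip m (f x) - g x)\<^sup>2"
      by (simp add: power2_eq_square algebra_simps)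
  qed (use ints in \<open>auto simp: square_int_def\<close>)
  also have "\<dots> = 2 * (LINT x|gauss. (f x - clip m (f x))\<^sup>2) + 2 * (LINT x|gauss. (clip m (f x) - g x)\<^sup>2)"
    using ints by (simp add: square_int_def)
  also have "\<dots> < e" using m n by (simp add: g_def)
  finally show ?thesis
    by (intro that[of g "real m"]) (auto simp: g_def continuous_on_clip h clip_bound)
qed

theorem parseval:
  assumes f: "square_int f"
  shows "(\<lambda>k. (hcoeff f k)\<^sup>2) sums (LINT x|gauss. (f x)\<^sup>2)"
proof -
  have "bessel_defect f \<le> 0 + e" if e: "0 < e" for e
  proof -
    obtain g B where g: "continuous_on UNIV g" "\<And>x. \<bar>g x\<bar> \<le> B"
      and small: "(LINT x|gauss. (f x - g x)\<^sup>2) < e / 2"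
      using square_int_approx[OF f, of "e / 2"] e by (metis half_gt_zero)
    have sq: "square_int g"
      by (rule bounded_square_int[OF borel_measurable_continuous_onI[OF g(1)] g(2)])
    note d = square_int_diff[OF f sq]
    have "bessel_defect f \<le> 2 * bessel_defect g + 2 * bessel_defect (\<lambda>x. f x - g x)"
      using bessel_defect_parallelogram[OF sq d] bessel_defect_nonneg[OF square_int_diff[OF sq d]]
      by simp
    also have "\<dots> \<le> e"
      using bessel_defect_continuous[OF g] bessel_defect_le[OF d] small by simp
    finally show ?thesis by simp
  qed
  then have "bessel_defect f \<le> 0" by (rule field_le_epsilon)
  then have "(\<Sum>k. (hcoeff f k)\<^sup>2) = (LINT x|gauss. (f x)\<^sup>2)"
    using bessel_defect_nonneg[OF f] by (simp add: bessel_defect_def)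
  then show ?thesis using summable_hcoeff[OF f] by (simp add: sums_iff)
qed

section \<open>Integration by parts against Hermite polynomials\<close>

text \<open>Polynomial times Gaussian is not compactly supported, so it is cut off by
  \<open>exp (-1 / (1 - x\<^sup>2 / n\<^sup>2))\<close>, which tends to the constant \<open>exp (-1)\<close> as \<open>n \<rightarrow> \<infinity>\<close>. Allowing powers of
  \<open>1 - x\<^sup>2 / n\<^sup>2\<close> in the denominator makes the family closed under differentiation.\<close>

definition flat_exp :: "nat \<Rightarrow> real \<Rightarrow> real" where
  "flat_exp j t = (if t > 0 then exp (- 1 / t) / t ^ j else 0)"

lemma flat_exp_tendsto_0: "(flat_exp j \<longlongrightarrow> 0) (at 0)"
proof -
  have "((\<lambda>t :: real. exp (- 1 / t) / t ^ j) \<longlongrightarrow> 0) (at_right 0)"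
    by real_asymp
  then have "(flat_exp j \<longlongrightarrow> 0) (at_right 0)"
    by (rule Lim_transform_eventually)
      (auto simp: flat_exp_def eventually_at_filter)
  moreover have "(flat_exp j \<longlongrightarrow> 0) (at_left 0)"
    by (rule tendsto_eventually)
      (auto simp: flat_exp_def eventually_at_filter)
  ultimately show ?thesis by (simp add: filterlim_split_at)
qed

lemma flat_exp_shift: "t * flat_exp (Suc j) t = flat_exp j t"
  by (simp add: flat_exp_def)

text \<open>At zero the difference quotient is \<open>flat_exp (Suc j)\<close>, which tends to 0;
  elsewhere the usual rules apply. One formula thus covers the point where the two branches
  meet.\<close>

lemma has_real_derivative_flat_exp:
  "(flat_exp j has_real_derivative flat_exp (j + 2) t - real j * flat_exp (j + 1) t) (at t)"
proof (cases t "0 :: real" rule: linorder_cases)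
  case less
  have "(flat_exp j has_real_derivative 0) (at t)"
    by (rule DERIV_cong_ev[THEN iffD1, OF refl _ refl DERIV_const[of 0]])
      (use less in \<open>auto simp: flat_exp_def intro: eventually_mono[OF eventually_nhds_in_open[of "{..<0}"]]\<close>)
  then show ?thesis using less by (simp add: flat_exp_def)
next
  case equal
  have "((\<lambda>h. (flat_exp j (0 + h) - flat_exp j 0) / h) \<longlongrightarrow> 0) (at 0)"
  proof (rule Lim_transform_eventually[OF flat_exp_tendsto_0[of "Suc j"]])
    show "\<forall>\<^sub>F h in at 0. flat_exp (Suc j) h = (flat_exp j (0 + h) - flat_exp j 0) / h"
      by (auto simp: eventually_at_filter flat_exp_def field_simps)
  qed
  then show ?thesis using equal by (simp add: DERIV_def flat_exp_def)
next
  case greater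
  have "((\<lambda>t. exp (- 1 / t) / t ^ j) has_real_derivative
      (exp (- 1 / t) * (1 / t\<^sup>2) * t ^ j - exp (- 1 / t) * (real j * t ^ (j - 1))) / (t ^ j * t ^ j)) (at t)"
    using greater by (auto intro!: derivative_eq_intros simp: power2_eq_square field_simps)
  also have "(exp (- 1 / t) * (1 / t\<^sup>2) * t ^ j - exp (- 1 / t) * (real j * t ^ (j - 1))) / (t ^ j * t ^ j)
      = flat_exp (j + 2) t - real j * flat_exp (j + 1) t"
    using greater by (cases j) (simp_all add: flat_exp_def field_simps power2_eq_square)
  finally show ?thesis
    by (rule DERIV_cong_ev[THEN iffD1, rotated -1, OF _ refl _ refl])
      (use greater in \<open>auto simp: flat_exp_def intro: eventually_mono[OF eventually_nhds_in_open[of "{0<..}"]]\<close>)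
qed

section \<open>Gaussian test functions with compact support\<close>

definition cutoff_arg :: "real \<Rightarrow> real \<Rightarrow> real" where
  "cutoff_arg n x = 1 - (x / n)\<^sup>2"

definition cutoff_gauss :: "real \<Rightarrow> real poly \<Rightarrow> nat \<Rightarrow> real \<Rightarrow> real" where
  "cutoff_gauss n p j x = poly p x * std_normal_density x * flat_exp j (cutoff_arg n x)"

lemma has_real_derivative_std_normal_density:
  "(std_normal_density has_real_derivative - x * std_normal_density x) (at x)"
proof -
  have "((\<lambda>x. 1 / sqrt (2 * pi) * exp (- x\<^sup>2 / 2)) has_real_derivative
      1 / sqrt (2 * pi) * (- x * exp (- x\<^sup>2 / 2))) (at x)"
    by (rule DERIV_cmult) (auto intro!: derivative_eq_intros)
  then show ?thesis by (simp add: std_normal_density_def[abs_def])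
qed

lemma has_real_derivative_cutoff_gauss:
  "(cutoff_gauss n p j has_real_derivative
     (poly (pderiv p) x - x * poly p x) * std_normal_density x * flat_exp j (cutoff_arg n x)
     - poly p x * std_normal_density x * (2 * x / n\<^sup>2)
       * (flat_exp (j + 2) (cutoff_arg n x) - real j * flat_exp (j + 1) (cutoff_arg n x))) (at x)"
proof -
  have *: "(cutoff_arg n has_real_derivative - 2 * x / n\<^sup>2) (at x)"
    unfolding cutoff_arg_def[abs_def]
    by (cases "n = 0") (auto intro!: derivative_eq_intros simp: power2_eq_square)
  show ?thesis
    unfolding cutoff_gauss_def[abs_def]
    by (rule derivative_eq_intros poly_DERIV has_real_derivative_std_normal_density
        DERIV_chain2[OF has_real_derivative_flat_exp *] refl)+
      (simp add: algebra_simps diff_divide_distrib)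
qed

text \<open>\<open>cutoff_arg n\<close> is itself a polynomial in \<open>x\<close>, called
  \<open>w\<close> here. All terms of the derivative are brought to the exponent
  \<open>j + 2\<close>, and the powers of \<open>w\<close> that this costs are absorbed into the
  polynomial factor \<open>q\<close>. Smoothness follows by iteration.\<close>

lemma deriv_cutoff_gauss:
  "\<exists>q. deriv (cutoff_gauss n p j) = cutoff_gauss n q (j + 2)"
proof -
  define w where "w = [:1, 0, - 1 / n\<^sup>2:]"
  have w: "poly w x = cutoff_arg n x" for x
    by (simp add: w_def cutoff_arg_def power2_eq_square)
  define q where "q = (pderiv p - pCons 0 p) * w\<^sup>2 - p * [:0, 2 / n\<^sup>2:] * (1 - smult (real j) w)"
  have "deriv (cutoff_gauss n p j) x = cutoff_gauss n q (j + 2) x" for x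
  proof -
    define t where "t = cutoff_arg n x"
    have "flat_exp (j + 1) t = t * flat_exp (j + 2) t" "flat_exp j t = t\<^sup>2 * flat_exp (j + 2) t"
      using flat_exp_shift[of t j] flat_exp_shift[of t "j + 1"]
      by (simp_all add: power2_eq_square mult.assoc)
    then show ?thesis
      unfolding DERIV_imp_deriv[OF has_real_derivative_cutoff_gauss]
      by (simp add: cutoff_gauss_def q_def w t_def[symmetric] algebra_simps diff_divide_distrib)
  qed
  then show ?thesis by blast
qed

lemma test_function_cutoff_gauss:
  assumes "n > 0"
  shows "test_function (cutoff_gauss n p j)"
proof -
  have "\<exists>q i. (deriv ^^ k) (cutoff_gauss n p j) = cutoff_gauss n q i" for k
  proof (induction k)
    case (Suc k)
    then show ?case using deriv_cutoff_gauss by (metis comp_apply funpow.simps(2))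
  qed auto
  moreover have "cutoff_gauss n q i differentiable_on UNIV" for q i
    unfolding differentiable_on_def real_differentiable_def
    using has_real_derivative_cutoff_gauss by blast
  ultimately have "\<forall>k. (deriv ^^ k) (cutoff_gauss n p j) differentiable_on UNIV"
    by metis
  moreover have "{x. cutoff_gauss n p j x \<noteq> 0} \<subseteq> {- n..n}"
  proof
    fix x assume "x \<in> {x. cutoff_gauss n p j x \<noteq> 0}"
    then have "cutoff_arg n x > 0" by (auto simp: cutoff_gauss_def flat_exp_def split: if_splits)
    then have "\<bar>x / n\<bar> < 1" unfolding cutoff_arg_def by (metis abs_square_less_1 diff_gt_0_iff_gt)
    then show "x \<in> {- n..n}" using assms by (auto simp: abs_less_iff field_simps)
  qed
  then have "compact (closure {x. cutoff_gauss n p j x \<noteq> 0})"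
    by (meson bounded_closed_interval bounded_subset compact_closure)
  ultimately show ?thesis by (simp add: test_function_def)
qed

text \<open>Bounds uniform in \<open>t\<close> for the two exponents that survive in the derivative
  of \<open>cutoff_gauss n p 0\<close>, where the exponent 1 carries the factor
  \<open>j = 0\<close>. The second is s^2 / 2 \<le> exp s at s = 1 / t.\<close>

lemma flat_exp_bound: "\<bar>flat_exp 0 t\<bar> \<le> 1" "\<bar>flat_exp 2 t\<bar> \<le> 2"
proof -
  show "\<bar>flat_exp 0 t\<bar> \<le> 1" by (simp add: flat_exp_def)
  show "\<bar>flat_exp 2 t\<bar> \<le> 2"
  proof (cases "t > 0")
    case True
    have "(1 / t)\<^sup>2 \<le> 2 * exp (1 / t)"
      using exp_lower_Taylor_quadratic[of "1 / t"] True by (smt (verit) divide_pos_pos zero_less_one field_sum_of_halves)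
    then have "(1 / t)\<^sup>2 * exp (- (1 / t)) \<le> 2 * exp (1 / t) * exp (- (1 / t))"
      by (rule mult_right_mono) simp
    also have "\<dots> = 2"
      by (simp add: mult.assoc flip: exp_add)
    finally have "(1 / t)\<^sup>2 * exp (- (1 / t)) \<le> 2" .
    then show ?thesis using True by (simp add: flat_exp_def power_divide)
  qed (simp add: flat_exp_def)
qed

text \<open>Local integrability is the source of measurability for an activation and its weak
  derivative; the restrictions to growing intervals converge pointwise.\<close>

lemma borel_measurable_set_integrable:
  fixes f :: "real \<Rightarrow> real"
  assumes "\<And>a b. set_integrable lborel {a..b} f"
  shows "f \<in> borel_measurable borel"
proof (rule borel_measurable_LIMSEQ_real)
  fix i :: nat
  show "(\<lambda>x. indicator {- real i..real i} x * f x) \<in> borel_measurable borel"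
    using borel_measurable_integrable[OF assms[of "- real i" "real i", unfolded set_integrable_def]]
    by simp
next
  fix x :: real
  show "(\<lambda>i. indicator {- real i..real i} x * f x) \<longlonglongrightarrow> f x"
  proof (rule tendsto_eventually)
    show "eventually (\<lambda>i. indicator {- real i..real i} x * f x = f x) sequentially"
      using eventually_ge_at_top[of "nat \<lceil>\<bar>x\<bar>\<rceil>"]
      by eventually_elim (auto simp: indicator_def abs_le_iff)
  qed
qed

lemma integral_gauss:
  assumes [measurable]: "f \<in> borel_measurable borel"
  shows "(LINT x|gauss. f x) = (LINT x|lborel. std_normal_density x * (f x :: real))"
    and "integrable gauss f \<longleftrightarrow> integrable lborel (\<lambda>x. std_normal_density x * f x)"
  by (simp_all add: integral_density integrable_density)

lemma square_int_poly: "square_int (poly p)"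
proof -
  have "(\<lambda>x. (poly p x)\<^sup>2) = poly (p * p)" by (auto simp: power2_eq_square)
  then show ?thesis by (simp add: square_int_def integrable_poly)
qed

text \<open>The weak derivative is tested against \<open>p\<close> times the Gaussian density times
  the cutoff. The derivative of the first two factors gives (p' - x p) times the density; the
  derivative of the cutoff disappears as its support grows.\<close>

lemma weak_derivative_gauss:
  assumes wd: "weak_derivative f f'" and f: "square_int f" and f': "square_int f'"
  shows "(LINT x|gauss. f x * (x * poly p x - poly (pderiv p) x)) = (LINT x|gauss. f' x * poly p x)"
proof -
  have [measurable]: "f \<in> borel_measurable borel" "f' \<in> borel_measurable borel"
    using f f' by (auto simp: square_int_def)
  let ?r = "pderiv p - pCons 0 p"
  \<comment> \<open>The scale is \<open>Suc n\<close> so that it is positive for every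
    index.\<close>
  define E where "E j n x = flat_exp j (cutoff_arg (real (Suc n)) x)" for j n x
  have [measurable]: "E j n \<in> borel_measurable borel" for j n
    unfolding E_def[abs_def] flat_exp_def cutoff_arg_def by measurable
  have E_lim: "(\<lambda>n. E 0 n x) \<longlonglongrightarrow> exp (- 1)" for x
  proof -
    have "(\<lambda>n. x / real (Suc n)) \<longlonglongrightarrow> 0"
      by (rule LIMSEQ_Suc[OF lim_const_over_n])
    then have "(\<lambda>n. cutoff_arg (real (Suc n)) x) \<longlonglongrightarrow> 1 - 0\<^sup>2"
      unfolding cutoff_arg_def by (intro tendsto_intros)
    then have "(\<lambda>n. cutoff_arg (real (Suc n)) x) \<longlonglongrightarrow> 1"
      by simp
    moreover have "isCont (flat_exp 0) 1"
      using has_real_derivative_flat_exp by (rule DERIV_isCont)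
    ultimately have "(\<lambda>n. E 0 n x) \<longlonglongrightarrow> flat_exp 0 1"
      unfolding E_def by (rule isCont_tendsto_compose[rotated])
    then show ?thesis by (simp add: flat_exp_def)
  qed
  have i1: "integrable gauss (\<lambda>x. f x * poly q x)" and i2: "integrable gauss (\<lambda>x. f' x * poly q x)" for q
    by (rule square_int_mult[OF f square_int_poly] square_int_mult[OF f' square_int_poly])+
  have eq: "(LINT x|gauss. (f x * poly ?r x) * E 0 n x
        - (f x * poly (pCons 0 p) x) * (2 / (real (Suc n))\<^sup>2 * E 2 n x))
      = - (LINT x|gauss. (f' x * poly p x) * E 0 n x)" for n
  proof -
    let ?\<psi> = "cutoff_gauss (real (Suc n)) p 0"
    have "(LINT x|lborel. f x * deriv ?\<psi> x) = - (LINT x|lborel. f' x * ?\<psi> x)"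
      using wd test_function_cutoff_gauss[of "real (Suc n)" p 0] by (simp add: weak_derivative_def)
    moreover have "(LINT x|lborel. f x * deriv ?\<psi> x)
        = (LINT x|gauss. (f x * poly ?r x) * E 0 n x
          - (f x * poly (pCons 0 p) x) * (2 / (real (Suc n))\<^sup>2 * E 2 n x))"
    proof -
      have m: "(\<lambda>x. (f x * poly ?r x) * E 0 n x
          - (f x * poly (pCons 0 p) x) * (2 / (real (Suc n))\<^sup>2 * E 2 n x)) \<in> borel_measurable borel"
        by measurable
      show ?thesis
        unfolding DERIV_imp_deriv[OF has_real_derivative_cutoff_gauss] integral_gauss(1)[OF m]
        by (intro Bochner_Integration.integral_cong refl)
          (simp add: E_def numeral_2_eq_2 algebra_simps del: of_nat_Suc)
    qed
    moreover have "(LINT x|lborel. f' x * ?\<psi> x) = (LINT x|gauss. (f' x * poly p x) * E 0 n x)"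
    proof -
      have m: "(\<lambda>x. (f' x * poly p x) * E 0 n x) \<in> borel_measurable borel"
        by measurable
      show ?thesis
        unfolding integral_gauss(1)[OF m]
        by (intro Bochner_Integration.integral_cong refl)
          (simp add: E_def cutoff_gauss_def mult_ac del: of_nat_Suc)
    qed
    ultimately show ?thesis by simp
  qed
  have "(\<lambda>n. LINT x|gauss. (f x * poly ?r x) * E 0 n x
        - (f x * poly (pCons 0 p) x) * (2 / (real (Suc n))\<^sup>2 * E 2 n x))
      \<longlonglongrightarrow> (LINT x|gauss. (f x * poly ?r x) * exp (- 1))"
  proof (rule integral_dominated_convergence
      [where w = "\<lambda>x. \<bar>f x * poly ?r x\<bar> + \<bar>f x * poly (pCons 0 p) x\<bar> * 4"])
    show "integrable gauss (\<lambda>x. \<bar>f x * poly ?r x\<bar> + \<bar>f x * poly (pCons 0 p) x\<bar> * 4)"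
      by (intro Bochner_Integration.integrable_add integrable_mult_left integrable_abs i1)
    \<comment> \<open>Differentiating the cutoff costs a factor of order 1 / n. The constant 4 is
      the coefficient 2 times the bound 2 for \<open>flat_exp 2\<close>.\<close>
    have c: "\<bar>2 / (real (Suc n))\<^sup>2 * E 2 n x\<bar> \<le> 4 * (1 / real (Suc n))" for n x
    proof -
      have "1 / (real (Suc n))\<^sup>2 \<le> 1 / real (Suc n)"
        by (intro divide_left_mono self_le_power mult_pos_pos) auto
      then have "2 / (real (Suc n))\<^sup>2 * \<bar>E 2 n x\<bar> \<le> (2 * (1 / real (Suc n))) * 2"
        by (intro mult_mono) (auto simp: E_def flat_exp_bound)
      then show ?thesis by (simp add: abs_mult)
    qed
    show "AE x in gauss. (\<lambda>n. (f x * poly ?r x) * E 0 n x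
        - (f x * poly (pCons 0 p) x) * (2 / (real (Suc n))\<^sup>2 * E 2 n x))
        \<longlonglongrightarrow> (f x * poly ?r x) * exp (- 1)"
    proof (intro AE_I2)
      fix x
      have "(\<lambda>n. 4 * (1 / real (Suc n))) \<longlonglongrightarrow> 0" by real_asymp
      then have "(\<lambda>n. 2 / (real (Suc n))\<^sup>2 * E 2 n x) \<longlonglongrightarrow> 0"
        by (rule Lim_null_comparison[rotated]) (auto simp only: real_norm_def c intro!: always_eventually)
      then have "(\<lambda>n. (f x * poly ?r x) * E 0 n x
        - (f x * poly (pCons 0 p) x) * (2 / (real (Suc n))\<^sup>2 * E 2 n x))
        \<longlonglongrightarrow> (f x * poly ?r x) * exp (- 1) - (f x * poly (pCons 0 p) x) * 0"
        by (intro tendsto_intros E_lim)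
      then show "(\<lambda>n. (f x * poly ?r x) * E 0 n x
        - (f x * poly (pCons 0 p) x) * (2 / (real (Suc n))\<^sup>2 * E 2 n x))
        \<longlonglongrightarrow> (f x * poly ?r x) * exp (- 1)" by simp
    qed
    show "AE x in gauss. norm ((f x * poly ?r x) * E 0 n x
        - (f x * poly (pCons 0 p) x) * (2 / (real (Suc n))\<^sup>2 * E 2 n x))
        \<le> \<bar>f x * poly ?r x\<bar> + \<bar>f x * poly (pCons 0 p) x\<bar> * 4" for n
    proof (intro AE_I2)
      fix x
      have "\<bar>2 / (real (Suc n))\<^sup>2 * E 2 n x\<bar> \<le> 4"
        using c[of n x] by (rule order_trans) (simp add: field_simps)
      then have "\<bar>(f x * poly (pCons 0 p) x) * (2 / (real (Suc n))\<^sup>2 * E 2 n x)\<bar>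
          \<le> \<bar>f x * poly (pCons 0 p) x\<bar> * 4"
        unfolding abs_mult[of "f x * poly (pCons 0 p) x"] by (rule mult_left_mono) simp
      moreover have "\<bar>(f x * poly ?r x) * E 0 n x\<bar> \<le> \<bar>f x * poly ?r x\<bar>"
        using flat_exp_bound(1) unfolding abs_mult[of "f x * poly ?r x"] E_def
        by (intro mult_left_le) auto
      ultimately show "norm ((f x * poly ?r x) * E 0 n x
        - (f x * poly (pCons 0 p) x) * (2 / (real (Suc n))\<^sup>2 * E 2 n x))
        \<le> \<bar>f x * poly ?r x\<bar> + \<bar>f x * poly (pCons 0 p) x\<bar> * 4"
        unfolding real_norm_def by linarith
    qed
  qed measurable
  moreover have "(\<lambda>n. - (LINT x|gauss. (f' x * poly p x) * E 0 n x))
      \<longlonglongrightarrow> - (LINT x|gauss. (f' x * poly p x) * exp (- 1))"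
  proof (intro tendsto_minus integral_dominated_convergence[where w = "\<lambda>x. \<bar>f' x * poly p x\<bar>"])
    show "AE x in gauss. (\<lambda>n. (f' x * poly p x) * E 0 n x) \<longlonglongrightarrow> (f' x * poly p x) * exp (- 1)"
      by (intro AE_I2 tendsto_intros E_lim)
    show "AE x in gauss. norm ((f' x * poly p x) * E 0 n x) \<le> \<bar>f' x * poly p x\<bar>" for n
    proof (intro AE_I2)
      fix x
      show "norm ((f' x * poly p x) * E 0 n x) \<le> \<bar>f' x * poly p x\<bar>"
        using flat_exp_bound(1) unfolding real_norm_def abs_mult[of "f' x * poly p x"] E_def
        by (intro mult_left_le) auto
    qed
  qed (use i2 in auto)
  ultimately have "(LINT x|gauss. (f x * poly ?r x) * exp (- 1)) = - (LINT x|gauss. (f' x * poly p x) * exp (- 1))"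
    unfolding eq by (rule LIMSEQ_unique)
  \<comment> \<open>The cutoff tends to the same nonzero constant on both sides, so it cancels and
    needs no normalization.\<close>
  then have "(LINT x|gauss. f x * poly ?r x) = - (LINT x|gauss. f' x * poly p x)"
    unfolding integral_mult_left_zero mult_minus_left[symmetric]
    by (simp only: mult_cancel_right exp_not_eq_zero simp_thms)
  moreover have "(LINT x|gauss. f x * poly ?r x) = (LINT x|gauss. - (f x * (x * poly p x - poly (pderiv p) x)))"
    by (simp add: algebra_simps)
  ultimately show ?thesis
    unfolding Bochner_Integration.integral_minus by linarith
qed

lemma hcoeff_weak_derivative:
  assumes "weak_derivative f f'" "square_int f" "square_int f'"
  shows "hcoeff f' k = sqrt (real (Suc k)) * hcoeff f (Suc k)"
proof -
  have "hcoeff f (Suc k) = (LINT x|gauss. f x * (x * poly (hermite k) x - poly (pderiv (hermite k)) x))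
      / sqrt (fact (Suc k))"
    unfolding hcoeff_def herm_def by simp
  also have "\<dots> = (LINT x|gauss. f' x * poly (hermite k) x) / sqrt (fact (Suc k))"
    by (simp only: weak_derivative_gauss[OF assms])
  also have "\<dots> = hcoeff f' k / sqrt (real (Suc k))"
    unfolding hcoeff_def herm_def by (simp add: real_sqrt_mult mult.commute)
  finally show ?thesis by simp
qed

lemma normalized_activation_square_int:
  assumes "normalized_activation \<phi> \<phi>'"
  shows "square_int \<phi>" "square_int \<phi>'"
  using assms borel_measurable_set_integrable
  by (auto simp: normalized_activation_def weak_derivative_def square_int_def)

section \<open>Iterated dual activations and the tangent kernel\<close>

text \<open>Collects what the passage to infinite depth uses about the activation, so that the rest
  is an argument about power series. The series identity omits z = -1 because derivatives are taken
  only at points of [0, 1].\<close>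

locale dual_power_series =
  fixes \<phi> :: "real \<Rightarrow> real" and c :: "nat \<Rightarrow> real"
  assumes c_nonneg: "0 \<le> c k"
    and c_0: "c 0 = 0" and c_1: "c 1 = 0"
    and c_sums: "c sums 1"
    and c_deriv_summable: "summable (\<lambda>k. real k * c k)"
    and dual_sums: "- 1 < z \<Longrightarrow> z \<le> 1 \<Longrightarrow> (\<lambda>k. c k * z ^ k) sums dual_activation \<phi> z"
begin

abbreviation "f \<equiv> dual_activation \<phi>"

definition f' :: "real \<Rightarrow> real" where
  "f' z = (\<Sum>k. real k * c k * z ^ (k - 1))"

lemma c_small: "k < 2 \<Longrightarrow> c k = 0"
  using c_0 c_1 by (cases k) auto

lemma f_sums: "0 \<le> z \<Longrightarrow> z \<le> 1 \<Longrightarrow> (\<lambda>k. c k * z ^ k) sums f z"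
  by (rule dual_sums) auto

lemma f'_sums:
  assumes "0 \<le> z" "z \<le> 1"
  shows "(\<lambda>k. real k * c k * z ^ (k - 1)) sums f' z"
  unfolding f'_def
proof (rule summable_sums, rule summable_comparison_test'[OF c_deriv_summable])
  show "norm (real k * c k * z ^ (k - 1)) \<le> real k * c k" for k
    using assms c_nonneg[of k] by (simp add: abs_mult mult_left_le power_le_one)
qed

lemma f_one: "f 1 = 1"
  using dual_sums[of 1] c_sums by (simp add: sums_iff)

text \<open>With no constant and no linear term, every power in the series has exponent at least 2,
  and at least 1 in the derived series; the comparison then holds term by term.\<close>

lemma f_le:
  assumes "0 \<le> w" "w \<le> r * z" "0 \<le> r" "r \<le> 1" "0 \<le> z" "z \<le> 1"
  shows "f w \<le> r\<^sup>2 * f z" "f' w \<le> r * f' z"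
proof -
  have w1: "w \<le> 1" using assms by (meson mult_le_one order_trans)
  have le: "w ^ k \<le> r ^ j * z ^ k" if "j \<le> k" for j k
  proof -
    have "w ^ k \<le> (r * z) ^ k" using assms by (intro power_mono) auto
    also have "\<dots> = r ^ k * z ^ k" by (rule power_mult_distrib)
    also have "\<dots> \<le> r ^ j * z ^ k"
      using assms that by (intro mult_right_mono power_decreasing) auto
    finally show ?thesis .
  qed
  show "f w \<le> r\<^sup>2 * f z"
  proof (rule sums_le)
    show "(\<lambda>k. c k * w ^ k) sums f w" by (rule f_sums[OF assms(1) w1])
    show "(\<lambda>k. r\<^sup>2 * (c k * z ^ k)) sums (r\<^sup>2 * f z)"
      by (intro sums_mult f_sums assms)
    show "c k * w ^ k \<le> r\<^sup>2 * (c k * z ^ k)" for k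
    proof (cases "k < 2")
      case False
      then have "c k * w ^ k \<le> c k * (r\<^sup>2 * z ^ k)"
        using c_nonneg by (intro mult_left_mono le) auto
      then show ?thesis by (simp add: mult_ac)
    qed (simp add: c_small)
  qed
  show "f' w \<le> r * f' z"
  proof (rule sums_le)
    show "(\<lambda>k. real k * c k * w ^ (k - 1)) sums f' w" by (rule f'_sums[OF assms(1) w1])
    show "(\<lambda>k. r * (real k * c k * z ^ (k - 1))) sums (r * f' z)"
      by (intro sums_mult f'_sums assms)
    show "real k * c k * w ^ (k - 1) \<le> r * (real k * c k * z ^ (k - 1))" for k
    proof (cases "k < 2")
      case False
      then have "real k * c k * w ^ (k - 1) \<le> real k * c k * (r ^ 1 * z ^ (k - 1))"
        using c_nonneg by (intro mult_left_mono le) auto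
      then show ?thesis by (simp add: mult_ac)
    qed (simp add: c_small)
  qed
qed

lemma f_nonneg: "0 \<le> z \<Longrightarrow> z \<le> 1 \<Longrightarrow> 0 \<le> f z"
  and f'_nonneg: "0 \<le> z \<Longrightarrow> z \<le> 1 \<Longrightarrow> 0 \<le> f' z"
  by (rule sums_le[OF _ sums_zero f_sums], simp_all add: c_nonneg)
    (rule sums_le[OF _ sums_zero f'_sums], simp_all add: c_nonneg)

lemma f_le_one: "0 \<le> z \<Longrightarrow> z \<le> 1 \<Longrightarrow> f z \<le> 1"
  using f_le(1)[of z 1 1] by (simp add: f_one)

lemma f_pos:
  assumes "0 < z" "z \<le> 1"
  shows "0 < f z"
proof -
  have "\<exists>k. c k \<noteq> 0"
    using c_sums sums_unique2[OF sums_zero, of 1] by (metis ext zero_neq_one)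
  then obtain k where k: "c k \<noteq> 0" by blast
  then have "0 < c k" using c_nonneg[of k] by simp
  then have "0 < (\<Sum>k. c k * z ^ k)"
    using f_sums[of z] assms c_nonneg
    by (intro suminf_pos2[of _ k]) (auto simp: sums_iff)
  then show ?thesis using f_sums[of z] assms by (simp add: sums_iff)
qed

lemma f_has_derivative:
  assumes z: "0 \<le> z" "z \<le> 1"
  shows "(f has_vector_derivative f' z) (at z within {-1..1})"
proof -
  have u: "uniform_limit {-1..1} (\<lambda>n x. \<Sum>k<n. real k * c k * x ^ (k - 1)) f' sequentially"
    unfolding f'_def[abs_def]
  proof (rule Weierstrass_m_test[OF _ c_deriv_summable])
    show "norm (real k * c k * x ^ (k - 1)) \<le> real k * c k" if "x \<in> {-1..1}" for k x
      using that c_nonneg[of k] by (auto simp: abs_mult power_abs intro!: mult_left_le power_le_one)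
  qed
  have d: "((\<lambda>x. c k * x ^ k) has_field_derivative real k * c k * x ^ (k - 1)) (at x within {-1..1})" for k x
    by (auto intro!: derivative_eq_intros)
  have "\<exists>g. \<forall>x\<in>{-1..1}. (\<lambda>k. c k * x ^ k) sums g x
      \<and> (g has_field_derivative f' x) (at x within {-1..1})"
    by (rule has_field_derivative_series[OF _ d u, of 1]) (use c_sums in \<open>auto simp: sums_iff\<close>)
  then obtain g where "\<forall>x\<in>{-1..1}. (\<lambda>k. c k * x ^ k) sums g x
      \<and> (g has_field_derivative f' x) (at x within {-1..1})" ..
  then have g: "\<And>x. x \<in> {-1..1} \<Longrightarrow> (\<lambda>k. c k * x ^ k) sums g x"
      "\<And>x. x \<in> {-1..1} \<Longrightarrow> (g has_field_derivative f' x) (at x within {-1..1})"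
    by blast+
  have "g x = f x" if "x \<in> {-1<..1}" for x
    using g(1)[of x] dual_sums[of x] that by (auto simp: sums_iff)
  \<comment> \<open>The transfer from \<open>g\<close> uses radius 1: since \<open>z\<close> is
    nonnegative, points of the interval at distance less than 1 stay off -1, where \<open>g\<close>
    and \<open>f\<close> have not been identified.\<close>
  then have "(f has_field_derivative f' z) (at z within {-1..1})"
    using g(2)[of z] z
    by (auto intro!: has_field_derivative_transform_within[of g "f' z" z "{-1..1}" 1 f] simp: dist_real_def)
  then show ?thesis by (simp add: has_real_derivative_iff_has_vector_derivative)
qed

lemma dual_activation_deriv_eq:
  assumes z: "0 \<le> z" "z \<le> 1"
  shows "dual_activation_deriv \<phi> z = f' z"
  unfolding dual_activation_deriv_def
  by (rule vector_derivative_within_cbox[where a = "- 1" and b = "1 :: real", simplified])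
    (use z f_has_derivative[OF z] in auto)

section \<open>Decay of iterates and kernel values with depth\<close>

lemma iter_range: "0 \<le> z \<Longrightarrow> z \<le> 1 \<Longrightarrow> 0 \<le> (f ^^ L) z \<and> (f ^^ L) z \<le> 1"
  by (induction L) (auto simp: f_nonneg f_le_one)

lemma iter_pos: "0 < z \<Longrightarrow> z \<le> 1 \<Longrightarrow> 0 < (f ^^ L) z"
  by (induction L) (use f_pos iter_range in \<open>auto simp: less_imp_le\<close>)

text \<open>Every layer squares the ratio, but only a linear growth of the exponent is recorded: for
  \<open>r < 1\<close> this already tends to 0, and the induction stays short.\<close>

lemma iter_ratio:
  assumes "0 \<le> w" "w \<le> r * z" "0 \<le> r" "r \<le> 1" "0 \<le> z" "z \<le> 1"
  shows "(f ^^ L) w \<le> r ^ Suc L * (f ^^ L) z"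
proof (induction L)
  case (Suc L)
  have "w \<le> 1" using assms by (meson mult_le_one order_trans)
  then have "f ((f ^^ L) w) \<le> (r ^ Suc L)\<^sup>2 * f ((f ^^ L) z)"
    using assms iter_range[of w L] iter_range[of z L]
    by (intro f_le(1) Suc.IH power_le_one) auto
  also have "\<dots> \<le> r ^ Suc (Suc L) * f ((f ^^ L) z)"
  proof (rule mult_right_mono)
    show "(r ^ Suc L)\<^sup>2 \<le> r ^ Suc (Suc L)"
      unfolding power_mult[symmetric] using assms by (intro power_decreasing) auto
  qed (use assms iter_range[of z L] in \<open>auto intro: f_nonneg\<close>)
  finally show ?case by simp
qed (use assms in auto)

lemma ntk_Suc:
  "0 \<le> z \<Longrightarrow> z \<le> 1 \<Longrightarrow> ntk \<phi> (Suc L) z = (f ^^ Suc L) z + ntk \<phi> L z * f' ((f ^^ L) z)"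
  using iter_range[of z L] by (simp add: dual_activation_deriv_eq)

lemma ntk_nonneg: "0 \<le> z \<Longrightarrow> z \<le> 1 \<Longrightarrow> 0 \<le> ntk \<phi> L z"
proof (induction L)
  case (Suc L)
  then show ?case
    using iter_range[of z L] iter_range[of z "Suc L"]
    by (simp only: ntk_Suc) (simp add: f'_nonneg)
qed simp

lemma ntk_pos:
  assumes "0 < z" "z \<le> 1"
  shows "0 < ntk \<phi> L z"
proof (cases L)
  case (Suc L')
  have "0 \<le> ntk \<phi> L' z * f' ((f ^^ L') z)"
    using assms iter_range[of z L'] by (intro mult_nonneg_nonneg ntk_nonneg f'_nonneg) auto
  then show ?thesis
    using iter_pos[OF assms, of "Suc L'"]
    unfolding Suc ntk_Suc[OF less_imp_le[OF assms(1)] assms(2)] by linarith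
qed (use assms in simp)

lemma ntk_mono:
  assumes "0 \<le> w" "w \<le> z" "z \<le> 1"
  shows "ntk \<phi> L w \<le> ntk \<phi> L z"
proof (induction L)
  case (Suc L)
  have "(f ^^ Suc L) w \<le> (f ^^ Suc L) z" "(f ^^ L) w \<le> (f ^^ L) z"
    using iter_ratio[of w 1 z "Suc L"] iter_ratio[of w 1 z L] assms by auto
  moreover have "f' ((f ^^ L) w) \<le> f' ((f ^^ L) z)"
    using f_le(2)[of "(f ^^ L) w" 1 "(f ^^ L) z"] calculation(2) iter_range[of w L] iter_range[of z L] assms
    by simp
  ultimately show ?case
    using assms Suc.IH iter_range[of w L]
    by (simp only: ntk_Suc order_trans[OF assms(2,3)] order_trans[OF assms(1,2)])
      (intro add_mono mult_mono ntk_nonneg f'_nonneg, auto)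
qed (use assms in simp)

text \<open>All decay is taken from the last layer: the iterate and the factor \<open>f'\<close>
  each gain \<open>r ^ Suc L\<close>, while the kernel of the previous depth needs only
  monotonicity. No induction over the kernel recursion is involved.\<close>

lemma ntk_ratio:
  assumes "0 \<le> w" "w \<le> r * z" "0 \<le> r" "r \<le> 1" "0 \<le> z" "z \<le> 1"
  shows "ntk \<phi> (Suc L) w \<le> r ^ Suc L * ntk \<phi> (Suc L) z"
proof -
  have wz: "w \<le> z" using assms by (meson mult_left_le_one_le order_trans)
  then have w1: "w \<le> 1" using assms by simp
  note rng = iter_range[OF assms(1) w1] iter_range[OF assms(5,6)]
  have "(f ^^ Suc L) w \<le> r ^ Suc (Suc L) * (f ^^ Suc L) z"
    by (rule iter_ratio[OF assms])
  also have "\<dots> \<le> r ^ Suc L * (f ^^ Suc L) z"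
    using assms rng(2)[of "Suc L"] by (intro mult_right_mono power_decreasing) auto
  finally have 1: "(f ^^ Suc L) w \<le> r ^ Suc L * (f ^^ Suc L) z" .
  have "f' ((f ^^ L) w) \<le> r ^ Suc L * f' ((f ^^ L) z)"
    using assms rng[of L] by (intro f_le(2) iter_ratio power_le_one) auto
  then have "ntk \<phi> L w * f' ((f ^^ L) w) \<le> ntk \<phi> L z * (r ^ Suc L * f' ((f ^^ L) z))"
    using assms wz w1 rng[of L] by (intro mult_mono ntk_mono ntk_nonneg f'_nonneg) auto
  with 1 show ?thesis
    by (simp only: ntk_Suc assms w1) (simp only: algebra_simps)
qed

lemma ntk_negligible:
  assumes "0 \<le> w" "w < z" "z \<le> 1" "0 < e"
  shows "\<forall>\<^sub>F L in sequentially. \<bar>ntk \<phi> L w\<bar> \<le> e * ntk \<phi> L z"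
proof -
  define r where "r = w / z"
  have r: "0 \<le> r" "r < 1" "w \<le> r * z" using assms by (auto simp: r_def)
  have "\<forall>\<^sub>F L in sequentially. r ^ L < e"
    using LIMSEQ_power_zero[of r] r assms(4) by (intro order_tendstoD) auto
  then show ?thesis
    using eventually_gt_at_top[of 0]
  proof eventually_elim
    case (elim L)
    then obtain L' where L: "L = Suc L'" by (cases L) auto
    have "ntk \<phi> L w \<le> r ^ L * ntk \<phi> L z"
      unfolding L using assms r by (intro ntk_ratio) auto
    also have "\<dots> \<le> e * ntk \<phi> L z"
      using elim assms by (intro mult_right_mono ntk_nonneg) auto
    finally show ?case using ntk_nonneg[of w L] assms by simp
  qed
qed

end

section \<open>Almost diagonal linear systems\<close>

text \<open>Row-wise diagonal dominance in the maximum norm. With \<open>m\<close> the largest entry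
  of \<open>a\<close> in absolute value, the row that attains it gives \<kappa> m \<le> \<kappa> m /
  2 + B; the resulting bound on \<kappa> m is fed back into every row.\<close>

lemma almost_diagonal_solution:
  fixes G :: "real ^ 'n ^ ('n :: finite)" and a k :: "real ^ 'n"
  assumes G: "G *v a = k" and \<kappa>: "0 < \<kappa>" and diag: "\<And>i. G $ i $ i = \<kappa>"
    and off: "\<And>i j. i \<noteq> j \<Longrightarrow> \<bar>G $ i $ j\<bar> \<le> e * \<kappa>"
    and e: "0 \<le> e" "real CARD('n) * e \<le> 1 / 2" and B: "\<And>j. \<bar>k $ j\<bar> \<le> B"
  shows "\<kappa> * \<bar>a $ j\<bar> \<le> 2 * B" "\<bar>\<kappa> * a $ j - k $ j\<bar> \<le> real CARD('n) * e * (2 * B)"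
proof -
  define m where "m = Max (range (\<lambda>j. \<bar>a $ j\<bar>))"
  have m: "\<bar>a $ j\<bar> \<le> m" for j by (simp add: m_def)
  have dev: "\<bar>\<kappa> * a $ j - k $ j\<bar> \<le> real CARD('n) * e * (\<kappa> * m)" for j
  proof -
    have "k $ j = (\<Sum>l\<in>UNIV. G $ j $ l * a $ l)"
      by (simp add: matrix_vector_mult_def flip: G)
    also have "\<dots> = \<kappa> * a $ j + (\<Sum>l\<in>UNIV - {j}. G $ j $ l * a $ l)"
      by (subst sum.remove[of _ j]) (auto simp: diag)
    finally have "\<bar>\<kappa> * a $ j - k $ j\<bar> = \<bar>\<Sum>l\<in>UNIV - {j}. G $ j $ l * a $ l\<bar>" by simp
    also have "\<dots> \<le> (\<Sum>l\<in>UNIV - {j}. e * \<kappa> * m)"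
      using off m e \<kappa>
      by (intro order_trans[OF sum_abs] sum_mono) (auto simp: abs_mult intro!: mult_mono)
    also have "\<dots> \<le> (\<Sum>l\<in>(UNIV :: 'n set). e * \<kappa> * m)"
      using e \<kappa> order_trans[OF abs_ge_zero m] by (intro sum_mono2) auto
    finally show ?thesis by (simp add: mult_ac)
  qed
  have "m \<in> range (\<lambda>j. \<bar>a $ j\<bar>)"
    unfolding m_def by (rule Max_in) auto
  then obtain i where i: "\<bar>a $ i\<bar> = m" by auto
  have "real CARD('n) * e * (\<kappa> * m) \<le> 1 / 2 * (\<kappa> * m)"
    using e \<kappa> i by (intro mult_right_mono) auto
  moreover have "\<kappa> * m = \<bar>\<kappa> * a $ i\<bar>" using \<kappa> i by (simp add: abs_mult)
  ultimately have km: "\<kappa> * m \<le> 2 * B" using dev[of i] B[of i] by linarith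
  show "\<kappa> * \<bar>a $ j\<bar> \<le> 2 * B"
    using mult_left_mono[OF m, of \<kappa> j] \<kappa> km by linarith
  show "\<bar>\<kappa> * a $ j - k $ j\<bar> \<le> real CARD('n) * e * (2 * B)"
    using dev[of j] mult_left_mono[OF km, of "real CARD('n) * e"] e by (simp add: order_trans)
qed

lemma almost_diagonal_invertible:
  fixes G :: "real ^ 'n ^ ('n :: finite)"
  assumes "0 < \<kappa>" "\<And>i. G $ i $ i = \<kappa>" "\<And>i j. i \<noteq> j \<Longrightarrow> \<bar>G $ i $ j\<bar> \<le> e * \<kappa>"
    "0 \<le> e" "real CARD('n) * e \<le> 1 / 2"
  shows "invertible G"
proof -
  have "a = 0" if "G *v a = 0" for a
  proof -
    have "\<kappa> * \<bar>a $ j\<bar> \<le> 2 * 0" for j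
      by (rule almost_diagonal_solution(1)[OF that assms]) simp_all
    then show ?thesis using \<open>0 < \<kappa>\<close> by (simp add: vec_eq_iff mult_le_0_iff)
  qed
  then show ?thesis
    by (simp add: invertible_left_inverse matrix_left_invertible_ker)
qed

text \<open>The tolerance is chosen for the sign argument: N rows with inversion error 2 N e each
  sum to 1/2, and the N minor entries of the kernel vector add at most 1/4, which together stays
  below 1.\<close>

lemma inverse_four_squares:
  assumes "1 \<le> N" "e = 1 / (4 * N\<^sup>2)"
  shows "0 < e" "N * e = 1 / (4 * N)" "N * e \<le> 1 / (2 :: real)"
proof -
  show "0 < e" using assms by simp
  show Ne: "N * e = 1 / (4 * N)" using assms by (simp add: power2_eq_square)
  show "N * e \<le> 1 / 2" unfolding Ne using assms(1) by (simp add: field_simps)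
qed

text \<open>After scaling by \<kappa> > 0 the prediction differs from y_i k_i by at most 3/4 of k_i,
  so it keeps the sign of y_i. Both error terms are measured against k_i, however small that entry
  is.\<close>

lemma almost_diagonal_sgn:
  fixes G :: "real ^ 'n ^ ('n :: finite)" and y k :: "real ^ 'n"
  assumes \<kappa>: "0 < \<kappa>" and diag: "\<And>i. G $ i $ i = \<kappa>"
    and off: "\<And>i j. i \<noteq> j \<Longrightarrow> \<bar>G $ i $ j\<bar> \<le> e * \<kappa>"
    and e: "e = 1 / (4 * (real CARD('n))\<^sup>2)"
    and y: "\<And>j. y $ j \<in> {- 1, 1}"
    and k: "0 < k $ i" "\<And>j. j \<noteq> i \<Longrightarrow> \<bar>k $ j\<bar> \<le> e * k $ i"
  shows "sgn ((y v* matrix_inv G) \<bullet> k) = y $ i"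
proof -
  define N where "N = real CARD('n)"
  have N: "N \<ge> 1" by (simp add: N_def Suc_le_eq)
  note e0 = inverse_four_squares(1)[OF N e[folded N_def]]
    and Ne = inverse_four_squares(2)[OF N e[folded N_def]]
    and Ne2 = inverse_four_squares(3)[OF N e[folded N_def]]
  have "1 * e \<le> N * e" using N e0 by (intro mult_right_mono) auto
  then have e1: "e \<le> 1" using Ne2 by simp
  define a where "a = matrix_inv G *v k"
  have "invertible G"
    using almost_diagonal_invertible[OF \<kappa> diag off] e0 Ne2 by (simp add: N_def)
  then have "G ** matrix_inv G = mat 1"
    unfolding invertible_def matrix_inv_def by (rule someI2_ex) simp
  then have Ga: "G *v a = k"
    by (simp add: a_def matrix_vector_mul_assoc)
  have kB: "\<bar>k $ j\<bar> \<le> k $ i" for j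
  proof (cases "j = i")
    case False
    have "e * k $ i \<le> k $ i" using e1 k(1) by simp
    with k(2)[OF False] show ?thesis by (rule order_trans)
  qed (use k(1) in simp)
  have dev: "\<bar>\<kappa> * a $ j - k $ j\<bar> \<le> N * e * (2 * k $ i)" for j
    using almost_diagonal_solution(2)[OF Ga \<kappa> diag off _ _ kB] e0 Ne2 by (simp add: N_def)
  have abs_y: "\<bar>y $ j\<bar> = 1" for j using y[of j] by auto
  have "\<bar>\<kappa> * (y \<bullet> a) - y $ i * k $ i\<bar> \<le> 3 / 4 * k $ i"
  proof -
    have "\<kappa> * (y \<bullet> a) = (\<Sum>j\<in>UNIV. y $ j * (\<kappa> * a $ j - k $ j)) + (\<Sum>j\<in>UNIV. y $ j * k $ j)"
      by (simp add: inner_vec_def sum_distrib_left algebra_simps flip: sum.distrib)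
    also have "(\<Sum>j\<in>UNIV. y $ j * k $ j) = y $ i * k $ i + (\<Sum>j\<in>UNIV - {i}. y $ j * k $ j)"
      by (subst sum.remove[of _ i]) auto
    finally have "\<bar>\<kappa> * (y \<bullet> a) - y $ i * k $ i\<bar>
        \<le> \<bar>\<Sum>j\<in>UNIV. y $ j * (\<kappa> * a $ j - k $ j)\<bar> + \<bar>\<Sum>j\<in>UNIV - {i}. y $ j * k $ j\<bar>"
      by linarith
    also have "\<bar>\<Sum>j\<in>UNIV. y $ j * (\<kappa> * a $ j - k $ j)\<bar> \<le> (\<Sum>j\<in>(UNIV :: 'n set). N * e * (2 * k $ i))"
      using dev by (intro order_trans[OF sum_abs] sum_mono) (simp add: abs_mult abs_y)
    also have "\<dots> = N * (N * e * (2 * k $ i))" by (simp add: N_def)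
    also have "\<dots> = 1 / 2 * k $ i" using N by (simp add: Ne)
    also have "\<bar>\<Sum>j\<in>UNIV - {i}. y $ j * k $ j\<bar> \<le> (\<Sum>j\<in>UNIV - {i}. e * k $ i)"
      using k(2) by (intro order_trans[OF sum_abs] sum_mono) (simp add: abs_mult abs_y)
    also have "\<dots> \<le> (\<Sum>j\<in>(UNIV :: 'n set). e * k $ i)"
      using e0 k(1) by (intro sum_mono2) auto
    also have "\<dots> = N * e * k $ i" by (simp add: N_def)
    also have "\<dots> \<le> 1 / 4 * k $ i"
      using N k(1) by (intro mult_right_mono) (auto simp: Ne field_simps)
    finally show ?thesis by simp
  qed
  then have "sgn (\<kappa> * (y \<bullet> a)) = y $ i"
    using k(1) y[of i] by (auto simp: sgn_if)
  then have "sgn (y \<bullet> a) = y $ i" using \<kappa> by (simp add: sgn_mult)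
  then show ?thesis by (simp add: a_def dot_lmul_matrix)
qed

section \<open>Nearest-neighbour classification\<close>

text \<open>The derivative rule at index 0 identifies a_1 with the mean of \<phi>'. Bessel's
  inequality for \<phi>' supplies the summability of k a_k^2.\<close>

lemma normalized_activation_power_series:
  assumes na: "normalized_activation \<phi> \<phi>'"
    and mean: "(LINT z|gauss. \<phi> z) = 0" and mean': "(LINT z|gauss. \<phi>' z) = 0"
  shows "dual_power_series \<phi> (\<lambda>k. (hcoeff \<phi> k)\<^sup>2)"
proof
  note sq = normalized_activation_square_int[OF na]
  have wd: "weak_derivative \<phi> \<phi>'" and one: "(LINT z|gauss. (\<phi> z)\<^sup>2) = 1"
    using na by (auto simp: normalized_activation_def)
  show "0 \<le> (hcoeff \<phi> k)\<^sup>2" for k by simp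
  show "(hcoeff \<phi> 0)\<^sup>2 = 0" using mean by (simp add: hcoeff_def herm_def)
  show "(hcoeff \<phi> 1)\<^sup>2 = 0"
    using hcoeff_weak_derivative[OF wd sq, of 0] mean' by (simp add: hcoeff_def herm_def)
  show sums: "(\<lambda>k. (hcoeff \<phi> k)\<^sup>2) sums 1" using parseval[OF sq(1)] by (simp add: one)
  have "summable (\<lambda>k. real (Suc k) * (hcoeff \<phi> (Suc k))\<^sup>2)"
    using summable_hcoeff[OF sq(2)]
    by (simp add: hcoeff_weak_derivative[OF wd sq] power_mult_distrib)
  then show "summable (\<lambda>k. real k * (hcoeff \<phi> k)\<^sup>2)"
    by (subst summable_Suc_iff[symmetric])
  show "(\<lambda>k. (hcoeff \<phi> k)\<^sup>2 * z ^ k) sums dual_activation \<phi> z" if "- 1 < z" "z \<le> 1" for z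
  proof (cases "z = 1")
    case True
    then show ?thesis using sums by (simp add: dual_activation_one[OF sq(1)] one)
  next
    case False
    then show ?thesis using that by (intro dual_activation_sums sq) auto
  qed
qed

text \<open>The orthant keeps inner products where the kernel is monotone, and unit length makes the
  nearest training input the one with the largest inner product.\<close>

lemma nonneg_sphere_inner:
  fixes u v :: "real ^ 'k::finite"
  assumes "u \<in> nonneg_sphere" "v \<in> nonneg_sphere"
  shows "0 \<le> u \<bullet> v" "u \<bullet> v = 1 - (dist u v)\<^sup>2 / 2"
proof -
  show "0 \<le> u \<bullet> v"
    using assms by (auto simp: nonneg_sphere_def inner_vec_def intro!: sum_nonneg)
  have "u \<bullet> u = 1" "v \<bullet> v = 1"
    using assms by (auto simp: nonneg_sphere_def dot_square_norm)
  then show "u \<bullet> v = 1 - (dist u v)\<^sup>2 / 2"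
    by (simp add: dist_norm power2_norm_eq_inner inner_diff inner_commute field_simps)
qed

text \<open>Eventual invertibility and convergence are asserted because \<open>matrix_inv\<close>
  and \<open>lim\<close> also denote something when there is no inverse or no limit. The condition
  for a single training point excludes orthogonality: at inner product 0 every K^L vanishes, as the
  dual activation fixes 0, so the sign would be 0 and not a label.\<close>

theorem theorem3:
  fixes d :: nat
    and \<phi> \<phi>' :: "real \<Rightarrow> real"
    and X :: "'n::finite \<Rightarrow> real ^ 'k::finite"
    and y :: "real ^ 'n"
    and A A' :: real
  assumes "d \<ge> 1"
    and "CARD('k) = d + 1"
    and "normalized_activation \<phi> \<phi>'"
    and "inj X"
    and "\<forall>i. X i \<in> nonneg_sphere"
    and "\<forall>i. y $ i \<in> {-1, 1}"
    and "A = (LINT z|std_normal_distribution. \<phi> z)"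
    and "A' = (LINT z|std_normal_distribution. \<phi>' z)"
    and "A = 0"
    and "A' = 0"
  shows "(\<forall>\<^sub>F L in sequentially. invertible (ntk_gram \<phi> L X)) \<and>
    (\<forall>x \<in> nonneg_sphere. \<forall>i.
       (\<forall>j. j \<noteq> i \<longrightarrow> dist x (X i) < dist x (X j)) \<longrightarrow>
       (CARD('n) = 1 \<longrightarrow> x \<bullet> X i \<noteq> 0) \<longrightarrow>
       convergent (\<lambda>L. ntk_sign \<phi> X y L x) \<and> deep_classifier \<phi> X y x = y $ i)"
proof -
  interpret dual_power_series \<phi> "\<lambda>k. (hcoeff \<phi> k)\<^sup>2"
    using assms(7-) by (intro normalized_activation_power_series[OF assms(3)]) auto
  define N where "N = real CARD('n)"
  define e where "e = 1 / (4 * (real CARD('n))\<^sup>2)"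
  have N: "N \<ge> 1" by (simp add: N_def Suc_le_eq)
  note e = inverse_four_squares(1,3)[OF N e_def[folded N_def]]
  have X: "X i \<in> nonneg_sphere" for i using assms by simp
  have diag: "ntk_gram \<phi> L X $ i $ i = ntk \<phi> L 1" for L i
    using nonneg_sphere_inner(2)[OF X X, of i i] by (simp add: ntk_gram_def)
  have \<kappa>: "0 < ntk \<phi> L 1" for L by (rule ntk_pos) auto
  have "\<forall>\<^sub>F L in sequentially. i \<noteq> j \<longrightarrow> \<bar>ntk_gram \<phi> L X $ i $ j\<bar> \<le> e * ntk \<phi> L 1" for i j
  proof (cases "i = j")
    case False
    then have "0 < dist (X i) (X j)" using \<open>inj X\<close> by (simp add: inj_eq)
    then have "X i \<bullet> X j < 1" by (simp add: nonneg_sphere_inner(2)[OF X X])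
    then show ?thesis
      using ntk_negligible[OF nonneg_sphere_inner(1)[OF X X] _ _ e(1), of i j 1]
      by (auto simp: ntk_gram_def elim: eventually_mono)
  qed simp
  then have off: "\<forall>\<^sub>F L in sequentially. \<forall>i j. i \<noteq> j \<longrightarrow> \<bar>ntk_gram \<phi> L X $ i $ j\<bar> \<le> e * ntk \<phi> L 1"
    by (intro eventually_all_finite)
  then have "\<forall>\<^sub>F L in sequentially. invertible (ntk_gram \<phi> L X)"
  proof eventually_elim
    case (elim L)
    show ?case
      by (rule almost_diagonal_invertible[OF \<kappa>[of L] diag, of e]) (use elim e in \<open>auto simp: N_def\<close>)
  qed
  moreover have "convergent (\<lambda>L. ntk_sign \<phi> X y L x) \<and> deep_classifier \<phi> X y x = y $ i"
    if x: "x \<in> nonneg_sphere" and near: "\<And>j. j \<noteq> i \<Longrightarrow> dist x (X i) < dist x (X j)"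
      and single: "CARD('n) = 1 \<Longrightarrow> x \<bullet> X i \<noteq> 0" for x i
  proof -
    have less: "X j \<bullet> x < X i \<bullet> x" if "j \<noteq> i" for j
    proof -
      have "(dist x (X i))\<^sup>2 < (dist x (X j))\<^sup>2"
        using near[OF that] by (simp add: power_strict_mono)
      then show ?thesis by (simp add: nonneg_sphere_inner(2)[OF X x] dist_commute)
    qed
    \<comment> \<open>A second training input has a nonnegative inner product with \<open>x\<close>,
      and the nearest one strictly exceeds it. With one input alone, positivity comes from the
      orthogonality condition.\<close>
    have pos: "0 < X i \<bullet> x"
    proof (cases "CARD('n) = 1")
      case True
      then show ?thesis
        using single nonneg_sphere_inner(1)[OF X x, of i] by (simp add: inner_commute less_le)
    next
      case False
      have "\<exists>j. j \<noteq> i"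
      proof (rule ccontr)
        assume "\<nexists>j. j \<noteq> i"
        then have "(UNIV :: 'n set) = {i}" by auto
        then have "CARD('n) = 1" by (metis card_1_singleton_iff One_nat_def)
        with False show False by simp
      qed
      then obtain j where "j \<noteq> i" by blast
      then show ?thesis
        using less[of j] nonneg_sphere_inner(1)[OF X x, of j] by simp
    qed
    have le1: "X i \<bullet> x \<le> 1" by (simp add: nonneg_sphere_inner(2)[OF X x])
    have "\<forall>\<^sub>F L in sequentially. j \<noteq> i \<longrightarrow> \<bar>ntk_vec \<phi> L X x $ j\<bar> \<le> e * ntk_vec \<phi> L X x $ i" for j
    proof (cases "j = i")
      case False
      then show ?thesis
        using ntk_negligible[OF nonneg_sphere_inner(1)[OF X x] less[OF False] le1 e(1)]
        by (auto simp: ntk_vec_def elim: eventually_mono)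
    qed simp
    then have "\<forall>\<^sub>F L in sequentially. \<forall>j. j \<noteq> i \<longrightarrow> \<bar>ntk_vec \<phi> L X x $ j\<bar> \<le> e * ntk_vec \<phi> L X x $ i"
      by (intro eventually_all_finite)
    with off have "\<forall>\<^sub>F L in sequentially. ntk_sign \<phi> X y L x = y $ i"
    proof eventually_elim
      case (elim L)
      show ?case
        unfolding ntk_sign_def
      proof (rule almost_diagonal_sgn[OF \<kappa>[of L] diag _ e_def])
        show "0 < ntk_vec \<phi> L X x $ i" using ntk_pos[OF pos le1] by (simp add: ntk_vec_def)
      qed (use elim assms in auto)
    qed
    then have "(\<lambda>L. ntk_sign \<phi> X y L x) \<longlonglongrightarrow> y $ i"
      by (rule tendsto_eventually)
    then show ?thesis
      unfolding deep_classifier_def by (auto simp: convergent_def limI)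
  qed
  ultimately show ?thesis by blast
qed

end
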